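(* Let $p$ be an odd prime and $e$ a positive integer with $e\equiv2\pmod4$ and $p\mid e$; put $q=p^e$. For $i\in\{0,1\}$ let $D_i=\{x\in\mathbb{F}_q:\mathrm{Tr}(x^{p+1}-x)\in C_i^{(2,p)}\}$ and $\mathcal{C}_{D_i}=\{(\mathrm{Tr}(ax))_{x\in D_i}:a\in\mathbb{F}_q\}$. Then $\mathcal{C}_{D_i}$ has length $\frac{p-1}{2}p^{e-1}+\frac{p-1}{2}p^{\frac e2-1}$ and dimension $e$, it has at most $4$ nonzero weights, and its weight distribution is (weight: number of codewords), with $W=\frac{(p-1)^2}{2}p^{e-2}$: - $0$: $1$; - $W$: $\frac{p+1}{2}p^{e-2}-1-\frac{p-1}{2}p^{\frac e2-1}$; - $W+\frac{p-1}{2}p^{\frac e2-1}$: $\frac{p^2-1}{2}p^{e-2}$; - $W+(p-1)p^{\frac e2-1}$: $\frac{p-1}{2}p^{e-2}+\frac{p-1}{2}p^{\frac e2-1}$; - $W+\frac{p-3}{2}p^{\frac e2-1}$: $\frac{(p-1)^2}{2}p^{e-2}$.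
   Context: $\mathrm{Tr}$ is the absolute trace $\mathbb{F}_q\to\mathbb{F}_p$. $C_0^{(2,p)}$ (resp. $C_1^{(2,p)}$) is the set of squares (resp. non-squares) in $\mathbb{F}_p^*$. Weights are Hamming weights. *)

theory Defs
  imports "HOL-Computational_Algebra.Primes" "HOL-Library.Cardinality"
begin

text \<open>Absolute trace F_q -> F_p, q = p^e, with values in the prime subfield of F_q.\<close>
definition tr :: "nat \<Rightarrow> nat \<Rightarrow> 'a::field \<Rightarrow> 'a" where
  "tr p e x = (\<Sum>i<e. x ^ (p ^ i))"

text \<open>Nonzero squares (C_0) and nonsquares (C_1) of the prime subfield F_p (= range of_nat).\<close>
definition sq_Fp :: "'a::field set" where
  "sq_Fp = {(of_nat k) ^ 2 | k. (of_nat k :: 'a) \<noteq> 0}"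

definition nsq_Fp :: "'a::field set" where
  "nsq_Fp = {of_nat k | k. (of_nat k :: 'a) \<noteq> 0} - sq_Fp"

definition codeword :: "nat \<Rightarrow> nat \<Rightarrow> 'a::field set \<Rightarrow> 'a \<Rightarrow> 'a \<Rightarrow> 'a" where
  "codeword p e D a = (\<lambda>x. if x \<in> D then tr p e (a * x) else 0)"

definition code :: "nat \<Rightarrow> nat \<Rightarrow> 'a::field set \<Rightarrow> ('a \<Rightarrow> 'a) set" where
  "code p e D = {codeword p e D a | a. True}"

definition hweight :: "'a set \<Rightarrow> ('a \<Rightarrow> 'b::zero) \<Rightarrow> nat" where
  "hweight D c = card {x \<in> D. c x \<noteq> 0}"

end

theory Submission
  imports Defs "HOL-Computational_Algebra.Polynomial" "HOL-Number_Theory.Cong"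
begin

text \<open>
  The form \<open>Q x = Tr (x^(p+1))\<close> on \<open>F_q\<close> has polar form
  \<open>B b y = Tr (L b * y)\<close> with \<open>L b = b^p + b^(1/p)\<close>, and \<open>L\<close> is bijective because
  \<open>-1\<close> is not a \<open>(p\<^sup>2 - 1)\<close>-st power when \<open>e/2\<close> is odd. Completing the square turns
  \<open>Tr (x^(p+1) - x)\<close> into \<open>Q (x - 1/2)\<close>, so the weight of the codeword of \<open>a = L b\<close> is governed
  by the number of \<open>y\<close> with \<open>Q y\<close> in a given square class and \<open>B b y = - Tr b\<close>.

  No Gauss sums are needed to count the level sets of \<open>Q\<close>. Every element of \<open>F_p\<^sup>*\<close> is of the
  form \<open>u^(p+1)\<close>, so all nonzero levels have the same size; counting pairs with equal
  values shows that the sizes \<open>N 0\<close> and \<open>N 1\<close> satisfy \<open>(N 0 - N 1)\<^sup>2 = q\<close>; and the sign is determined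
  modulo \<open>p + 1\<close>, because the \<open>p + 1\<close> elements \<open>u\<close> with \<open>u^(p+1) = 1\<close> act freely on nonzero
  vectors. On the hyperplanes \<open>B b y = s\<close> the count depends only on the square class of the discriminant
  \<open>s\<^sup>2 - 4 Q(b) t\<close>, which leaves three unknowns satisfying three linear equations.
\<close>

section \<open>Roots of unity in finite fields\<close>

lemma
  fixes c :: "'a::idom"
  assumes "n > 0"
  shows finite_power_eq: "finite {x. x ^ n = c}" and card_power_eq_le: "card {x. x ^ n = c} \<le> n"
proof -
  let ?f = "monom 1 n - [:c:] :: 'a poly"
  have deg: "degree ?f = n"
    using assms by (subst diff_conv_add_uminus, subst degree_add_eq_left) (auto simp: degree_monom_eq)
  then have "?f \<noteq> 0" using assms by force
  from poly_roots_finite[OF this] card_poly_roots_bound[OF this]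
  show "finite {x. x ^ n = c}" and "card {x. x ^ n = c} \<le> n"
    by (simp_all add: poly_monom deg)
qed

text \<open>Fibres of \<open>x ^ k\<close> have at most \<open>k\<close> elements, so its image has
  at least \<open>n\<close>, while \<open>y ^ n = 1\<close> has at most \<open>n\<close> solutions.
  Cyclicity of the multiplicative group is thus avoided.\<close>

lemma power_image_roots_of_unity:
  fixes G :: "'a::field set"
  assumes G: "G = {x. x ^ (n * k) = 1}" and card: "card G = n * k" and pos: "n * k > 0"
  shows "(\<lambda>x. x ^ k) ` G = {y. y ^ n = 1}" and "card {y::'a. y ^ n = 1} = n"
proof -
  have n: "n > 0" and k: "k > 0" using pos by auto
  have fin: "finite G" using card pos by (metis card.infinite less_not_refl)
  let ?I = "(\<lambda>x. x ^ k) ` G"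
  have sub: "?I \<subseteq> {y. y ^ n = 1}"
    by (auto simp: G power_mult[symmetric] mult.commute)
  have le: "card {y::'a. y ^ n = 1} \<le> n"
    by (rule card_power_eq_le[OF n])
  have "G \<subseteq> (\<Union>y\<in>?I. {x. x ^ k = y})" by auto
  then have "card G \<le> card (\<Union>y\<in>?I. {x. x ^ k = y})"
    by (intro card_mono finite_UN_I) (auto simp: fin finite_power_eq[OF k])
  also have "\<dots> \<le> (\<Sum>y\<in>?I. card {x. x ^ k = y})"
    by (intro card_UN_le finite_imageI fin)
  also have "\<dots> \<le> (\<Sum>y\<in>?I. k)"
    by (intro sum_mono card_power_eq_le k)
  finally have "n * k \<le> card ?I * k" using card by simp
  then have ge: "n \<le> card ?I" using k by simp
  show eq: "?I = {y. y ^ n = 1}"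
    by (rule card_seteq[OF finite_power_eq[OF n] sub]) (use le ge in linarith)
  show "card {y::'a. y ^ n = 1} = n" using eq le ge by simp
qed

text \<open>Multiplication by \<open>x\<close> permutes the nonzero elements and so preserves their
  product.\<close>

lemma power_card_minus_1_eq_1:
  fixes x :: "'a::{finite,field}"
  assumes "x \<noteq> 0"
  shows "x ^ (CARD('a) - 1) = 1"
proof -
  have "(\<Prod>y\<in>UNIV - {0}. x * y) = \<Prod>(UNIV - {0})"
    by (rule prod.reindex_bij_witness[of _ "\<lambda>y. y / x" "\<lambda>y. x * y"]) (use assms in auto)
  then have "x ^ (CARD('a) - 1) * \<Prod>(UNIV - {0::'a}) = \<Prod>(UNIV - {0})"
    by (simp add: prod.distrib)
  then show ?thesis by simp
qed

lemma roots_of_unity_finite_field: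
  assumes "CARD('a::{finite,field}) - 1 = n * k"
  shows "(\<lambda>x::'a. x ^ k) ` (UNIV - {0}) = {y. y ^ n = 1}" and "card {y::'a. y ^ n = 1} = n"
proof -
  have pos: "n * k > 0"
  proof -
    have "card {0, 1 :: 'a} \<le> CARD('a)" by (rule card_mono) auto
    then have "CARD('a) - 1 > 0" by simp
    then show ?thesis unfolding assms .
  qed
  have U: "UNIV - {0::'a} = {x. x ^ (n * k) = 1}"
  proof (intro set_eqI)
    fix x :: 'a
    show "x \<in> UNIV - {0} \<longleftrightarrow> x \<in> {x. x ^ (n * k) = 1}"
      using power_card_minus_1_eq_1[of x] pos unfolding assms
      by (cases "x = 0") (simp_all add: zero_power)
  qed
  have C: "card (UNIV - {0::'a}) = n * k" using assms by simp
  show "(\<lambda>x::'a. x ^ k) ` (UNIV - {0}) = {y. y ^ n = 1}" and "card {y::'a. y ^ n = 1} = n"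
    by (rule power_image_roots_of_unity[OF U C pos])+
qed

section \<open>The trace of a finite field\<close>

locale odd_finite_field =
  fixes p e :: nat and ty :: "'a::{finite,field} itself"
  assumes p_prime: "prime p" and p_odd: "odd p" and e_pos: "e > 0"
    and char: "CHAR('a) = p" and card: "CARD('a) = p ^ e"
begin

abbreviation Tr :: "'a \<Rightarrow> 'a" where "Tr \<equiv> tr p e"

definition Fp :: "'a set" where "Fp = range of_nat"

lemma p_ge_3: "p \<ge> 3"
  using p_prime p_odd prime_ge_2_nat[of p] by (cases "p = 2") auto

lemma frobenius_add: "(x + y :: 'a) ^ p ^ n = x ^ p ^ n + y ^ p ^ n"
  by (rule freshmans_dream') (simp_all add: char p_prime)

lemma frobenius_add1: "(x + y :: 'a) ^ p = x ^ p + y ^ p"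
  using frobenius_add[of x y 1] by simp

lemma power_q: "(x::'a) ^ p ^ e = x"
proof (cases "x = 0")
  case False
  then have "x * x ^ (p ^ e - 1) = x" using power_card_minus_1_eq_1[of x] by (simp add: card)
  moreover have "Suc (p ^ e - 1) = p ^ e" using p_ge_3 by simp
  ultimately show ?thesis by (metis power_Suc)
qed (use p_ge_3 in simp)

lemma of_nat_power_p: "(of_nat k :: 'a) ^ p = of_nat k"
  by (induction k) (use p_ge_3 in \<open>simp_all add: frobenius_add1 zero_power\<close>)

lemma card_Fp: "card Fp = p"
proof -
  have "Fp = of_nat ` {..<p}"
  proof -
    have "(of_nat k :: 'a) = of_nat (k mod p)" for k
      by (simp add: of_nat_eq_iff_cong_CHAR char cong_def)
    then show ?thesis unfolding Fp_def using p_ge_3 by force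
  qed
  moreover have "inj_on (of_nat :: nat \<Rightarrow> 'a) {..<p}"
    by (auto intro!: inj_onI simp: of_nat_eq_iff_cong_CHAR char cong_def)
  ultimately show ?thesis by (metis card_image card_lessThan)
qed

text \<open>The \<open>p\<close> elements of the prime field already exhaust the possible roots of
  X^p - X.\<close>

lemma Fp_eq: "Fp = {x. x ^ p = x}"
proof (rule card_seteq)
  show "Fp \<subseteq> {x. x ^ p = x}" by (auto simp: Fp_def of_nat_power_p)
  let ?f = "monom 1 p - [:0, 1:] :: 'a poly"
  have "degree ?f = p"
    using p_ge_3 by (subst diff_conv_add_uminus, subst degree_add_eq_left) (auto simp: degree_monom_eq)
  then have "card {x. poly ?f x = 0} \<le> p"
    using card_poly_roots_bound[of ?f] p_ge_3 by force
  then show "card {x::'a. x ^ p = x} \<le> card Fp" by (simp add: poly_monom card_Fp)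
qed simp

lemma Fp_0 [simp]: "0 \<in> Fp" and Fp_1 [simp]: "1 \<in> Fp"
  using p_ge_3 by (auto simp: Fp_eq zero_power)

lemma Fp_add [intro]: "x \<in> Fp \<Longrightarrow> y \<in> Fp \<Longrightarrow> x + y \<in> Fp"
  by (simp add: Fp_eq frobenius_add1)

lemma Fp_mult [intro]: "x \<in> Fp \<Longrightarrow> y \<in> Fp \<Longrightarrow> x * y \<in> Fp"
  by (simp add: Fp_eq power_mult_distrib)

lemma Fp_uminus [intro]: "x \<in> Fp \<Longrightarrow> - x \<in> Fp"
  by (simp add: Fp_eq p_odd)

lemma Fp_diff [intro]: "x \<in> Fp \<Longrightarrow> y \<in> Fp \<Longrightarrow> x - y \<in> Fp"
  using Fp_add[of x "-y"] by auto

lemma Fp_divide [intro]: "x \<in> Fp \<Longrightarrow> y \<in> Fp \<Longrightarrow> x / y \<in> Fp"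
  by (simp add: Fp_eq power_divide)

lemma Fp_power [intro]: "x \<in> Fp \<Longrightarrow> x ^ n \<in> Fp"
  by (induction n) auto

lemma Fp_numeral [simp]: "numeral n \<in> Fp"
  unfolding Fp_def by (metis of_nat_numeral rangeI)

lemma finite_Fp [simp]: "finite Fp"
  by (rule finite)

lemma sum_Fp: "sum f Fp = f 0 + (\<Sum>t\<in>Fp - {0}. f t)"
  by (rule sum.remove) auto

lemma Fp_power_p: "x \<in> Fp \<Longrightarrow> x ^ p = x"
  by (simp add: Fp_eq)

lemma Fp_power_p_n: "x \<in> Fp \<Longrightarrow> x ^ p ^ n = x"
  by (induction n) (simp_all add: power_mult Fp_power_p)

lemma Fp_nonzero: "Fp - {0} = {x. x ^ (p - 1) = 1}"
proof -
  have "x ^ p = x \<longleftrightarrow> x ^ (p - 1) = 1" if "x \<noteq> 0" for x :: 'a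
  proof -
    have "x ^ p = x * x ^ (p - 1)" using p_ge_3 by (metis power_Suc Suc_pred' gr0I not_numeral_le_zero)
    then show ?thesis using that by simp
  qed
  moreover have "(0::'a) ^ (p - 1) \<noteq> 1" using p_ge_3 by (simp add: zero_power)
  ultimately have "x \<in> Fp - {0} \<longleftrightarrow> x \<in> {x. x ^ (p - 1) = 1}" for x
    by (cases "x = 0") (simp_all add: Fp_eq)
  then show ?thesis by (rule set_eqI)
qed

lemma two_neq_0 [simp]: "(2::'a) \<noteq> 0"
proof
  assume "(2::'a) = 0"
  then have "p dvd 2" by (metis char of_nat_eq_0_iff_char_dvd of_nat_numeral)
  then show False using p_ge_3 by (auto dest: dvd_imp_le)
qed

lemma one_neq_minus_one: "(1::'a) \<noteq> - 1"
  using two_neq_0 by (metis add_neg_numeral_special(7) one_add_one add.right_inverse)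

lemma four_neq_0 [simp]: "(4::'a) \<noteq> 0"
  using two_neq_0 by (metis mult_2 no_zero_divisors numeral_Bit0)

lemma tr_add: "Tr (x + y) = Tr x + Tr y"
  by (simp add: tr_def frobenius_add sum.distrib)

lemma tr_0 [simp]: "Tr 0 = 0"
  using p_ge_3 by (simp add: tr_def zero_power)

lemma tr_scale: "c \<in> Fp \<Longrightarrow> Tr (c * x) = c * Tr x"
  by (simp add: tr_def power_mult_distrib Fp_power_p_n sum_distrib_left)

lemma tr_uminus: "Tr (- x) = - Tr x"
  using tr_add[of x "-x"] by (simp add: minus_unique)

lemma tr_diff: "Tr (x - y) = Tr x - Tr y"
  using tr_add[of x "-y"] by (simp add: tr_uminus)

text \<open>The Frobenius map shifts the summands of the trace cyclically, since
  \<open>x ^ p ^ e = x\<close>.\<close>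

lemma tr_frobenius: "Tr (x ^ p) = Tr x"
proof -
  have "Tr (x ^ p) = (\<Sum>i<e. x ^ p ^ Suc i)"
    by (simp add: tr_def power_mult mult.commute flip: power_mult)
  also have "\<dots> = (\<Sum>i<Suc e. x ^ p ^ i) - x"
    by (simp only: sum.lessThan_Suc_shift) simp
  also have "\<dots> = Tr x" by (simp add: tr_def power_q)
  finally show ?thesis .
qed

lemma tr_power_p: "Tr x ^ p = Tr x"
proof -
  have "Tr x ^ p = Tr (x ^ p)"
    unfolding tr_def
    by (subst freshmans_dream_sum) (simp_all add: char p_prime mult.commute flip: power_mult)
  then show ?thesis by (simp add: tr_frobenius)
qed

lemma tr_in_Fp [simp]: "Tr x \<in> Fp"
  by (simp add: Fp_eq tr_power_p)

text \<open>As a polynomial, the trace has degree at most \<open>p ^ (e - 1)\<close>, which is less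
  than the number of field elements.\<close>

lemma tr_nonzero: "\<exists>x. Tr x \<noteq> 0"
proof (rule ccontr)
  assume "\<not> ?thesis"
  then have all: "Tr x = 0" for x by auto
  let ?f = "\<Sum>i<e. monom 1 (p ^ i) :: 'a poly"
  \<comment> \<open>The exponents \<open>p ^ i\<close> are distinct, so the top monomial survives
    and the polynomial is nonzero.\<close>
  have "coeff ?f (p ^ (e - 1)) = (\<Sum>i<e. if i = e - 1 then 1 else 0)"
    unfolding coeff_sum coeff_monom using p_ge_3 by (intro sum.cong refl) auto
  also have "\<dots> = 1" using e_pos by simp
  finally have "?f \<noteq> 0" by (metis coeff_0 zero_neq_one)
  then have "card {x. poly ?f x = 0} \<le> degree ?f" by (rule card_poly_roots_bound)
  also have "\<dots> \<le> p ^ (e - 1)"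
    using p_ge_3 by (intro degree_sum_le) (auto intro!: order.trans[OF degree_monom_le] power_increasing)
  finally have "p ^ e \<le> p ^ (e - 1)"
    using all by (simp add: poly_sum poly_monom tr_def flip: card)
  moreover have "p ^ (e - 1) < p ^ e" using p_ge_3 e_pos by (intro power_strict_increasing) auto
  ultimately show False by simp
qed

lemma tr_mult_nonzero:
  assumes "a \<noteq> 0"
  shows "\<exists>x. Tr (a * x) \<noteq> 0"
proof -
  obtain y where "Tr y \<noteq> 0" using tr_nonzero by blast
  then have "Tr (a * (y / a)) \<noteq> 0" using assms by simp
  then show ?thesis by blast
qed

text \<open>Multiples by \<open>Fp\<close> of one \<open>y\<close> with \<open>Tr (a * y)\<close>
  nonzero translate the zero fibre onto every other, so \<open>p\<close> fibres share the
  \<open>p ^ e\<close> elements equally.\<close>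

lemma card_tr_fiber:
  assumes "a \<noteq> 0" "s \<in> Fp"
  shows "card {x. Tr (a * x) = s} = p ^ (e - 1)"
proof -
  obtain y where y: "Tr (a * y) \<noteq> 0" using tr_mult_nonzero[OF assms(1)] by blast
  let ?n = "card {x. Tr (a * x) = 0}"
  have fiber: "card {x. Tr (a * x) = t} = ?n" if t: "t \<in> Fp" for t
  proof -
    let ?c = "t / Tr (a * y)"
    have c: "?c \<in> Fp" using t by auto
    have sh: "Tr (a * (?c * y)) = t"
      using tr_scale[OF c, of "a * y"] y by (simp add: mult_ac)
    show ?thesis
      by (rule bij_betw_same_card[of "\<lambda>x. x - ?c * y"],
          rule bij_betw_byWitness[where f' = "\<lambda>x. x + ?c * y"])
        (use sh in \<open>auto simp: distrib_left right_diff_distrib tr_add tr_diff simp del: times_divide_eq_left times_divide_eq_right\<close>)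
  qed
  have "p ^ e = card (\<Union>t\<in>Fp. {x. Tr (a * x) = t})"
    unfolding card[symmetric] by (rule arg_cong[where f = card]) auto
  also have "\<dots> = (\<Sum>t\<in>Fp. card {x. Tr (a * x) = t})"
    by (intro card_UN_disjoint) auto
  also have "\<dots> = (\<Sum>t\<in>Fp. ?n)" by (rule sum.cong[OF refl fiber])
  also have "\<dots> = p * ?n" by (simp add: card_Fp)
  finally have "p * p ^ (e - 1) = p * ?n"
    using e_pos by (metis power_eq_if not_gr_zero)
  then have "p ^ (e - 1) = ?n" using p_ge_3 by simp
  then show ?thesis using fiber[OF assms(2)] by simp
qed

end

section \<open>The quadratic form\<close>

lemma power_eq_geometric_sum_nat:
  fixes x :: nat
  assumes "x > 0"
  shows "x ^ n = 1 + (x - 1) * (\<Sum>i<n. x ^ i)"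
proof (induction n)
  case (Suc n)
  have "1 + (x - 1) * (\<Sum>i<Suc n. x ^ i) = x ^ n + (x - 1) * x ^ n"
    using Suc by (simp add: algebra_simps)
  also have "\<dots> = x ^ Suc n" using assms by (cases x) simp_all
  finally show ?case by simp
qed simp

lemma odd_geometric_sum_iff:
  fixes x :: nat
  assumes "odd x"
  shows "odd (\<Sum>i<n. x ^ i) \<longleftrightarrow> odd n"
  by (induction n) (use assms in auto)

lemma card_eq_sum_fibers:
  assumes "finite A" "finite T" "\<And>x. x \<in> A \<Longrightarrow> f x \<in> T"
  shows "int (card A) = (\<Sum>t\<in>T. int (card {x \<in> A. f x = t}))"
proof -
  have "card A = card (\<Union>t\<in>T. {x \<in> A. f x = t})"
    using assms(3) by (intro arg_cong[where f = card]) auto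
  also have "\<dots> = (\<Sum>t\<in>T. card {x \<in> A. f x = t})"
    using assms by (intro card_UN_disjoint) auto
  finally show ?thesis by simp
qed

lemma card_pairs:
  fixes R :: "'a::finite \<Rightarrow> 'b::finite \<Rightarrow> bool"
  shows "int (card {(x, z). R x z}) = (\<Sum>x\<in>UNIV. int (card {z. R x z}))"
proof -
  have "{(x, z). R x z} = (SIGMA x:UNIV. {z. R x z})" by auto
  then show ?thesis by simp
qed

locale trace_code = odd_finite_field +
  assumes e_mod: "e mod 4 = 2" and p_dvd_e: "p dvd e"
begin

definition Q :: "'a \<Rightarrow> 'a" where "Q x = Tr (x ^ (p + 1))"
definition L :: "'a \<Rightarrow> 'a" where "L b = b ^ p + b ^ p ^ (e - 1)"
definition B :: "'a \<Rightarrow> 'a \<Rightarrow> 'a" where "B b y = Tr (L b * y)"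

abbreviation m :: nat where "m \<equiv> e div 2"
abbreviation h :: nat where "h \<equiv> p ^ (m - 1)"

lemma e_eq: "e = 2 * m" and odd_m: "odd m"
  using e_mod by presburger+

lemma of_nat_e: "(of_nat e :: 'a) = 0"
  using p_dvd_e by (simp add: of_nat_eq_0_iff_char_dvd char)

text \<open>On the prime field the trace is multiplication by \<open>e\<close>, and \<open>p\<close>
  divides \<open>e\<close>.\<close>

lemma tr_Fp: "c \<in> Fp \<Longrightarrow> Tr c = 0"
  by (simp add: tr_def Fp_power_p_n of_nat_e)

text \<open>The cofactor is a sum of \<open>m\<close> powers of \<open>p ^ 2\<close>, all odd, with
  \<open>m\<close> odd. Its parity makes \<open>L\<close> injective; the factor
  \<open>p ^ 2 - 1\<close> controls the map \<open>x ^ (p + 1)\<close>.\<close>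

lemma q_minus_1: "\<exists>k. odd k \<and> CARD('a) - 1 = (p ^ 2 - 1) * k"
proof -
  have "p ^ e = (p ^ 2) ^ m" using e_eq by (metis power_mult)
  also have "\<dots> = 1 + (p ^ 2 - 1) * (\<Sum>i<m. (p ^ 2) ^ i)"
    using p_ge_3 by (intro power_eq_geometric_sum_nat) simp
  finally have "CARD('a) - 1 = (p ^ 2 - 1) * (\<Sum>i<m. (p ^ 2) ^ i)" using card by simp
  moreover have "odd (\<Sum>i<m. (p ^ 2) ^ i)"
    using odd_geometric_sum_iff[of "p ^ 2" m] p_odd odd_m by simp
  ultimately show ?thesis by blast
qed

lemma p_sq_minus_1: "p ^ 2 - 1 = (p - 1) * (p + 1)"
  using p_ge_3 by (cases p) (simp_all add: power2_eq_square algebra_simps)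

text \<open>The nonzero \<open>(p + 1)\<close>-st powers are the solutions of
  \<open>y ^ ((p - 1) * k) = 1\<close>, and these include all of \<open>Fp - {0}\<close>.\<close>

lemma ex_norm:
  assumes "c \<in> Fp" "c \<noteq> 0"
  shows "\<exists>l::'a. l \<noteq> 0 \<and> l ^ (p + 1) = c"
proof -
  obtain k where k: "CARD('a) - 1 = (p ^ 2 - 1) * k" using q_minus_1 by blast
  then have "CARD('a) - 1 = ((p - 1) * k) * (p + 1)" by (simp only: p_sq_minus_1 mult_ac)
  from roots_of_unity_finite_field(1)[OF this]
  have "(\<lambda>x::'a. x ^ (p + 1)) ` (UNIV - {0}) = {y. y ^ ((p - 1) * k) = 1}" .
  moreover have "c ^ (p - 1) = 1" using assms Fp_nonzero by blast
  then have "c ^ ((p - 1) * k) = 1" by (simp add: power_mult)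
  ultimately have "c \<in> (\<lambda>x::'a. x ^ (p + 1)) ` (UNIV - {0})" by blast
  then show ?thesis by auto
qed

lemma card_norm_1: "card {x::'a. x ^ (p + 1) = 1} = p + 1"
proof -
  obtain k where k: "CARD('a) - 1 = (p ^ 2 - 1) * k" using q_minus_1 by blast
  then have "CARD('a) - 1 = (p + 1) * ((p - 1) * k)" by (simp only: p_sq_minus_1 mult_ac)
  from roots_of_unity_finite_field(2)[OF this] show ?thesis .
qed

lemma Q_in_Fp [simp]: "Q x \<in> Fp" and B_in_Fp [simp]: "B x y \<in> Fp"
  by (simp_all add: Q_def B_def)

text \<open>Frobenius invariance of the trace turns \<open>b ^ p ^ (e - 1) * y\<close> into
  \<open>b * y ^ p\<close>. In this form symmetry is visible, and \<open>B\<close> is recognisable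
  as the polar form of \<open>Q\<close>.\<close>

lemma B_eq: "B b y = Tr (b ^ p * y + b * y ^ p)"
proof -
  have "Tr (b ^ p ^ (e - 1) * y) = Tr ((b ^ p ^ (e - 1) * y) ^ p)"
    by (simp add: tr_frobenius)
  also have "(b ^ p ^ (e - 1) * y) ^ p = b ^ p ^ e * y ^ p"
    using e_pos by (simp add: power_mult_distrib power_mult[symmetric] power_Suc[symmetric]
        mult.commute[of _ p] del: power_Suc)
  finally show ?thesis
    by (simp add: B_def L_def distrib_right tr_add power_q)
qed

lemma B_commute: "B x y = B y x"
  by (simp add: B_eq mult_ac add_ac)

lemma Q_add: "Q (x + y) = Q x + Q y + B x y"
  by (simp add: Q_def B_eq frobenius_add1 tr_add algebra_simps)

lemma B_add: "B b (x + y) = B b x + B b y"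
  by (simp add: B_def distrib_left tr_add)

lemma B_0 [simp]: "B b 0 = 0" and Q_0 [simp]: "Q 0 = 0"
  by (simp_all add: B_def Q_def)

lemma B_scale: "c \<in> Fp \<Longrightarrow> B b (c * x) = c * B b x"
  using tr_scale[of c "L b * x"] by (simp add: B_def mult_ac)

lemma B_self: "B b b = 2 * Q b"
  using tr_scale[of 2 "b ^ (p + 1)"] by (simp add: B_eq Q_def mult.commute flip: mult_2)

lemma Q_mult:
  assumes "l ^ (p + 1) = c" "c \<in> Fp"
  shows "Q (l * x) = c * Q x"
  using tr_scale[OF assms(2), of "x ^ (p + 1)"] assms(1)
  by (simp only: Q_def power_mult_distrib)

lemma Q_scale: "c \<in> Fp \<Longrightarrow> Q (c * x) = c ^ 2 * Q x"
  by (rule Q_mult) (auto simp: Fp_power_p power2_eq_square)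

text \<open>A nonzero kernel element would satisfy \<open>b ^ (p ^ 2 - 1) = - 1\<close>; raising
  this to the odd power from \<open>q_minus_1\<close> contradicts
  \<open>b ^ (CARD('a) - 1) = 1\<close>. Hence the polar form is nondegenerate.\<close>

lemma L_eq_0_iff: "L b = 0 \<longleftrightarrow> b = 0"
proof
  assume L: "L b = 0"
  show "b = 0"
  proof (rule ccontr)
    assume b: "b \<noteq> 0"
    have "p * p = p ^ 2" "p ^ (e - 1) * p = p ^ e"
      using e_pos by (simp_all add: power2_eq_square flip: power_Suc2)
    then have "L b ^ p = b ^ p ^ 2 + b ^ p ^ e"
      by (simp only: L_def frobenius_add1 flip: power_mult)
    then have "b ^ p ^ 2 = - b"
      using L p_ge_3 by (simp add: power_q zero_power eq_neg_iff_add_eq_0)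
    moreover have "b ^ p ^ 2 = b * b ^ (p ^ 2 - 1)"
      using p_ge_3 by (metis Suc_pred' power_Suc zero_less_power not_numeral_le_zero gr0I)
    ultimately have "b ^ (p ^ 2 - 1) = - 1" using b
      by (metis mult_cancel_left mult_minus1_right)
    moreover obtain k where k: "odd k" "CARD('a) - 1 = (p ^ 2 - 1) * k" using q_minus_1 by blast
    ultimately have "b ^ (CARD('a) - 1) = - 1" by (simp add: power_mult)
    then show False using power_card_minus_1_eq_1[OF b] one_neq_minus_one by simp
  qed
next
  assume "b = 0"
  then show "L b = 0" using p_ge_3 by (simp add: L_def zero_power)
qed

lemma L_add: "L (x + y) = L x + L y"
  by (simp add: L_def frobenius_add frobenius_add1)

lemma bij_L: "bij L"
proof -
  have "inj L"
  proof (rule injI)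
    fix x y assume "L x = L y"
    moreover have "L x = L (x - y) + L y" by (simp flip: L_add)
    ultimately have "L (x - y) = 0" by simp
    then show "x = y" by (simp add: L_eq_0_iff)
  qed
  then show ?thesis by (simp add: bij_def finite_UNIV_inj_surj)
qed

lemma card_B_fiber:
  assumes "b \<noteq> 0" "s \<in> Fp"
  shows "card {y. B b y = s} = p ^ (e - 1)"
  unfolding B_def by (rule card_tr_fiber) (use assms in \<open>auto simp: L_eq_0_iff\<close>)

text \<open>Makes the trace a polar functional, up to the factor 2, of the vector \<open>1\<close>.
  This serves both to complete the square and to count codewords by \<open>Tr b\<close>.\<close>

lemma B_one: "B b 1 = 2 * Tr b"
  by (simp add: B_eq tr_add tr_frobenius)

lemma Q_one: "Q 1 = 0"
  by (simp add: Q_def tr_Fp)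

text \<open>Completing the square: since \<open>p\<close> divides \<open>e\<close>, the trace and the form vanish at \<open>1/2\<close>.\<close>

lemma tr_shift: "Tr ((y + 1/2) ^ (p + 1) - (y + 1/2)) = Q y"
proof -
  have half: "1/2 \<in> Fp" by (intro Fp_divide) auto
  have "B y (1/2) = Tr y" using B_scale[OF half, of y 1] by (simp add: B_one)
  moreover have "Q (1/2) = 0" using Q_scale[OF half, of 1] by (simp add: Q_one)
  moreover have "Tr (1/2) = 0" by (rule tr_Fp[OF half])
  ultimately show ?thesis
    using Q_add[of y "1/2"] by (simp only: tr_diff Q_def tr_add) simp
qed

lemma tr_L_shift: "Tr (L b * (y + 1/2)) = B b y + Tr b"
proof -
  have half: "1/2 \<in> Fp" by (intro Fp_divide) auto
  have "B b (1/2) = Tr b" using B_scale[OF half, of b 1] by (simp add: B_one)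
  then show ?thesis using B_add[of b y "1/2"] by (simp only: B_def)
qed

section \<open>Level sets of the quadratic form\<close>

definition level :: "'a \<Rightarrow> int" where "level t = int (card {x. Q x = t})"

text \<open>Multiplication by an \<open>l\<close> with \<open>l ^ (p + 1) = c\<close> maps one level
  set onto the other; this works for nonsquare \<open>c\<close> as well.\<close>

lemma level_scale:
  assumes "c \<in> Fp" "c \<noteq> 0"
  shows "level (c * t) = level t"
proof -
  obtain l where l: "l \<noteq> 0" "l ^ (p + 1) = c" using ex_norm[OF assms] by blast
  have Ql: "Q (l * x) = c * Q x" for x by (rule Q_mult[OF l(2) assms(1)])
  have "{x. Q x = c * t} = (*) l ` {x. Q x = t}"
  proof (intro equalityI subsetI)
    fix x assume "x \<in> {x. Q x = c * t}"
    then have "Q (x / l) = t" using Ql[of "x / l"] l(1) assms(2) by simp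
    then show "x \<in> (*) l ` {x. Q x = t}" using l(1) by (intro image_eqI[of _ _ "x / l"]) auto
  qed (auto simp: Ql)
  moreover have "inj_on ((*) l) {x. Q x = t}" using l(1) by (simp add: inj_on_def)
  ultimately show ?thesis unfolding level_def by (metis card_image)
qed

lemma level_eq_level_1:
  assumes "t \<in> Fp" "t \<noteq> 0"
  shows "level t = level 1"
  using level_scale[OF assms, of 1] by simp

lemma card_Fp_nonzero: "card (Fp - {0}) = p - 1"
  by (simp add: card_Fp)

lemma level_sum: "level 0 + (int p - 1) * level 1 = int p ^ e"
proof -
  have "int (p ^ e) = (\<Sum>t\<in>Fp. level t)"
    using card_eq_sum_fibers[of UNIV Fp Q] by (simp add: level_def card)
  also have "\<dots> = level 0 + (\<Sum>t\<in>Fp - {0}. level 1)"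
    unfolding sum_Fp
    by (intro arg_cong2[where f = "(+)"] sum.cong refl) (metis level_eq_level_1 Diff_iff singletonI)
  also have "\<dots> = level 0 + (int p - 1) * level 1"
    using p_ge_3 by (simp add: card_Fp_nonzero of_nat_diff)
  finally show ?thesis by simp
qed

text \<open>Both sides count the pairs \<open>(x, x + z)\<close> on which the form takes equal values.\<close>

lemma level_sum_squares: "level 0 ^ 2 + (int p - 1) * level 1 ^ 2 = int p ^ e + (int p ^ e - 1) * int p ^ (e - 1)"
proof -
  let ?S = "{(x, z). Q (x + z) = Q x}"
  have "int (card ?S) = (\<Sum>x\<in>UNIV. int (card {z. Q (x + z) = Q x}))"
    by (rule card_pairs)
  also have "\<dots> = (\<Sum>x\<in>UNIV. level (Q x))"
    unfolding level_def
    by (intro sum.cong refl arg_cong[where f = int] bij_betw_same_card[of "\<lambda>z. _ + z"]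
        bij_betw_byWitness[where f' = "\<lambda>y. y - _"]) auto
  also have "\<dots> = (\<Sum>t\<in>Fp. \<Sum>x\<in>{x. Q x = t}. level (Q x))"
    using sum.group[of UNIV Fp Q "\<lambda>x. level (Q x)"] by (auto simp: image_subset_iff)
  also have "\<dots> = (\<Sum>t\<in>Fp. level t ^ 2)"
    by (intro sum.cong) (auto simp: level_def power2_eq_square)
  also have "\<dots> = level 0 ^ 2 + (\<Sum>t\<in>Fp - {0}. level 1 ^ 2)"
    unfolding sum_Fp
    by (intro arg_cong2[where f = "(+)"] sum.cong refl) (metis level_eq_level_1 Diff_iff singletonI)
  also have "\<dots> = level 0 ^ 2 + (int p - 1) * level 1 ^ 2"
    using p_ge_3 by (simp add: card_Fp_nonzero of_nat_diff)
  finally have 1: "int (card ?S) = level 0 ^ 2 + (int p - 1) * level 1 ^ 2" .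
  \<comment> \<open>With the difference \<open>z\<close> fixed first, \<open>Q x\<close> cancels and
    the condition on \<open>x\<close> becomes affine.\<close>
  have "card ?S = card {(z, x). Q (x + z) = Q x}"
    by (rule bij_betw_same_card[of prod.swap]) (auto intro!: bij_betw_byWitness[where f' = prod.swap])
  also have "int \<dots> = (\<Sum>z\<in>UNIV. int (card {x. Q (x + z) = Q x}))"
    by (rule card_pairs)
  also have "\<dots> = (\<Sum>z\<in>UNIV. if z = (0::'a) then int p ^ e else int p ^ (e - 1))"
  proof (intro sum.cong refl)
    fix z
    have "{x. Q (x + z) = Q x} = {x. B z x = - Q z}"
      by (auto simp: Q_add B_commute[of z] eq_neg_iff_add_eq_0 add.commute)
    then show "int (card {x. Q (x + z) = Q x}) = (if z = 0 then int p ^ e else int p ^ (e - 1))"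
      using card_B_fiber[of z "- Q z"] card Fp_uminus[OF Q_in_Fp, of z] by auto
  qed
  also have "\<dots> = int p ^ e + (int p ^ e - 1) * int p ^ (e - 1)"
    by (subst sum.remove[of _ 0]) (use p_ge_3 in \<open>auto simp: card of_nat_diff\<close>)
  finally show ?thesis using 1 by simp
qed

text \<open>The elements of norm 1 form a group of order \<open>p + 1\<close> acting freely on nonzero vectors.\<close>

lemma dvd_card_norm_1_invariant:
  assumes inv: "\<And>u x. u ^ (p + 1) = 1 \<Longrightarrow> x \<in> A \<Longrightarrow> u * x \<in> A" and "0 \<notin> A"
  shows "p + 1 dvd card (A :: 'a set)"
proof -
  let ?U = "{u::'a. u ^ (p + 1) = 1}"
  define O' where "O' x = (\<lambda>u. u * x) ` ?U" for x :: 'a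
  have U0: "u \<noteq> 0" if "u \<in> ?U" for u using that by auto
  \<comment> \<open>Orbits of nonzero vectors are full fibres of \<open>x ^ (p + 1)\<close>, so two
    orbits that meet coincide.\<close>
  have mem: "y \<in> O' x \<longleftrightarrow> (y / x) ^ (p + 1) = 1" if "x \<noteq> 0" for x y
    using that by (auto simp: O'_def image_iff intro!: exI[of _ "y / x"] simp del: power_Suc)
  have card_orb: "card (O' x) = p + 1" if "x \<in> A" for x
    unfolding O'_def using that assms(2)
    by (subst card_image) (auto simp: inj_on_def card_norm_1[simplified])
  have part: "O' x = O' y" if "x \<in> A" "y \<in> A" and meet: "O' x \<inter> O' y \<noteq> {}" for x y
  proof -
    have nz: "x \<noteq> 0" "y \<noteq> 0" using that assms(2) by auto
    obtain z where z: "(z / x) ^ (p + 1) = 1" "(z / y) ^ (p + 1) = 1"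
      using meet nz mem by blast
    then have "x ^ (p + 1) = y ^ (p + 1)" using nz by (simp add: power_divide del: power_Suc)
    then have "(w / x) ^ (p + 1) = (w / y) ^ (p + 1)" for w by (simp only: power_divide)
    then show ?thesis using nz by (auto simp: mem simp del: power_Suc)
  qed
  have un: "\<Union>(O' ` A) = A"
  proof
    show "\<Union>(O' ` A) \<subseteq> A" using inv by (auto simp: O'_def)
    show "A \<subseteq> \<Union>(O' ` A)" by (force simp: O'_def image_iff intro: bexI[of _ 1])
  qed
  have "card (O' ` A) * (p + 1) = card (\<Union>(O' ` A))"
  proof (subst mult.commute, rule card_partition)
    show "c1 \<inter> c2 = {}" if "c1 \<in> O' ` A" "c2 \<in> O' ` A" "c1 \<noteq> c2" for c1 c2
      using that part by blast
  qed (use card_orb in auto)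
  then show ?thesis unfolding un by (metis dvd_triv_right)
qed

text \<open>Factors \<open>u\<close> with \<open>u ^ (p + 1) = 1\<close> preserve \<open>Q\<close>,
  so \<open>p + 1\<close> divides the size of level 1 and that of level 0 without the
  origin.\<close>

lemma level_diff_cong: "int p + 1 dvd level 0 - level 1 - 1"
proof -
  have Qinv: "Q (u * x) = Q x" if "u ^ (p + 1) = 1" for u x
    using Q_mult[OF that] by simp
  have "p + 1 dvd card {x. Q x = 1}"
    using Qinv by (intro dvd_card_norm_1_invariant) auto
  then have 1: "int p + 1 dvd level 1" unfolding level_def by (metis of_nat_Suc Suc_eq_plus1 add.commute of_nat_dvd_iff)
  have "p + 1 dvd card ({x. Q x = 0} - {0})"
    using Qinv by (intro dvd_card_norm_1_invariant) auto
  moreover have "int (card ({x. Q x = 0} - {0})) = level 0 - 1"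
  proof -
    have "card {x. Q x = 0} > 0" by (auto simp: card_gt_0_iff intro: exI[of _ 0])
    then show ?thesis unfolding level_def by (subst card_Diff_singleton) (simp_all add: of_nat_diff)
  qed
  ultimately have 2: "int p + 1 dvd level 0 - 1" by (metis of_nat_Suc Suc_eq_plus1 add.commute of_nat_dvd_iff)
  show ?thesis using dvd_diff[OF 2 1] by (simp add: algebra_simps)
qed

text \<open>The linear and quadratic identities leave \<open>d ^ 2 = p ^ e\<close>. The congruence
  modulo \<open>p + 1\<close> selects the sign, since \<open>p ^ m\<close> is congruent to -1 for
  odd \<open>m\<close>.\<close>

lemma level_diff: "level 0 - level 1 = - (int p ^ m)"
proof -
  define d where "d = level 0 - level 1"
  let ?q = "int p ^ e"
  have q: "?q = int p * int p ^ (e - 1)" using e_pos by (metis power_eq_if not_gr_zero)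
  have l0: "level 0 = level 1 + d" by (simp add: d_def)
  have pN: "int p * level 1 = ?q - d" using level_sum l0 by (simp add: algebra_simps)
  \<comment> \<open>After multiplication by \<open>p\<close>, \<open>level 1\<close> occurs only
    through \<open>p * level 1\<close>, which is \<open>p ^ e - d\<close>.\<close>
  have "int p * (level 0 ^ 2 + (int p - 1) * level 1 ^ 2)
      = (int p * level 1) ^ 2 + 2 * (int p * level 1) * d + int p * d ^ 2"
    by (simp add: l0 power2_eq_square algebra_simps)
  also have "\<dots> = ?q ^ 2 + (int p - 1) * d ^ 2"
    unfolding pN by (simp add: power2_eq_square algebra_simps)
  finally have "?q ^ 2 + (int p - 1) * d ^ 2 = int p * ?q + (?q - 1) * ?q"
    unfolding level_sum_squares by (simp add: q algebra_simps)
  then have "(int p - 1) * d ^ 2 = (int p - 1) * ?q"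
    by (simp add: power2_eq_square algebra_simps)
  then have "d ^ 2 = ?q" using p_ge_3 by simp
  also have "?q = (int p ^ m) ^ 2" using e_eq by (metis power_mult mult.commute)
  finally have "d = int p ^ m \<or> d = - (int p ^ m)" by (simp add: power2_eq_iff)
  moreover have "d \<noteq> int p ^ m"
  proof
    assume "d = int p ^ m"
    then have 1: "int p + 1 dvd int p ^ m - 1" using level_diff_cong by (simp add: d_def)
    have "int p + 1 dvd int p ^ m + 1"
    proof -
      have "int p - (-1) dvd int p ^ m - (-1) ^ m" by (simp only: power_diff_sumr2 dvd_triv_left)
      then show ?thesis using odd_m by simp
    qed
    from dvd_diff[OF this 1] have "int p + 1 dvd 2" by simp
    then show False using p_ge_3 by (auto dest: zdvd_imp_le)
  qed
  ultimately show ?thesis by (simp add: d_def)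
qed

lemma m_pos: "m > 0" using odd_m by (cases m) auto

lemma p_power_m: "int p ^ m = int p * int h"
  using m_pos by (metis of_nat_mult of_nat_power power_eq_if not_gr_zero)

lemma level_1: "level 1 = int p ^ (e - 1) + int h"
proof -
  have "int p ^ e = int p * int p ^ (e - 1)" using e_pos by (metis power_eq_if not_gr_zero)
  then have "int p * level 1 = int p * (int p ^ (e - 1) + int h)"
    using level_sum level_diff p_power_m by (simp add: algebra_simps)
  then show ?thesis using p_ge_3 by simp
qed

lemma level_0: "level 0 = int p ^ (e - 1) - (int p - 1) * int h"
  using level_diff level_1 p_power_m by (simp add: algebra_simps)

end

context odd_finite_field
begin

section \<open>The quadratic character of the prime field\<close>

abbreviation l :: nat where "l \<equiv> (p - 1) div 2"

lemma p_eq: "p = 2 * l + 1"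
  using p_odd p_ge_3 by simp

lemma l_pos: "l > 0"
  using p_ge_3 p_odd by auto

text \<open>Euler's criterion serves as the definition.\<close>

definition eta :: "'a \<Rightarrow> int" where
  "eta u = (if u = 0 then 0 else if u ^ l = 1 then 1 else - 1)"

lemma eta_0 [simp]: "eta 0 = 0" and eta_1 [simp]: "eta 1 = 1"
  by (simp_all add: eta_def)

lemma Fp_power_l:
  assumes "u \<in> Fp" "u \<noteq> 0"
  shows "u ^ l = 1 \<or> u ^ l = - 1"
proof -
  have "u ^ (p - 1) = 1" using assms Fp_nonzero by blast
  moreover have "p - 1 = l * 2" using p_eq by simp
  ultimately have "(u ^ l) ^ 2 = 1" by (metis power_mult)
  then show ?thesis by (simp add: power2_eq_1_iff)
qed

lemma eta_mult:
  assumes "x \<in> Fp" "y \<in> Fp"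
  shows "eta (x * y) = eta x * eta y"
proof (cases "x = 0 \<or> y = 0")
  case False
  then have "x ^ l = 1 \<or> x ^ l = - 1" "y ^ l = 1 \<or> y ^ l = - 1"
    using Fp_power_l assms by auto
  then show ?thesis
    using False one_neq_minus_one by (elim disjE) (simp_all add: eta_def power_mult_distrib)
qed auto

lemma eta_cases:
  assumes "u \<in> Fp" "u \<noteq> 0"
  obtains "eta u = 1" | "eta u = - 1"
  using assms unfolding eta_def by presburger

lemma eta_square:
  assumes "c \<in> Fp" "c \<noteq> 0"
  shows "eta (c ^ 2) = 1"
  using eta_mult[OF assms(1,1)] eta_cases[OF assms] by (metis mult_1 mult_minus_left
      power2_eq_square minus_minus)

lemma eta_square_mult:
  assumes "c \<in> Fp" "c \<noteq> 0" "u \<in> Fp"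
  shows "eta (c ^ 2 * u) = eta u"
  using eta_mult[of "c ^ 2" u] eta_square[OF assms(1,2)] assms by auto

text \<open>Squaring maps the group \<open>Fp - {0}\<close> of order \<open>2 * l\<close> onto the
  solutions of \<open>y ^ l = 1\<close>, which are half of it.\<close>

lemma eta_eq_1_iff: "u \<in> Fp \<and> eta u = 1 \<longleftrightarrow> u \<in> (\<lambda>c. c ^ 2) ` (Fp - {0})"
  and card_eta_eq_1: "card {u \<in> Fp. eta u = 1} = l"
proof -
  have k: "p - 1 = l * 2" using p_eq by simp
  have G: "Fp - {0} = {x. x ^ (l * 2) = 1}" using Fp_nonzero k by simp
  have C: "card (Fp - {0}) = l * 2" using card_Fp k by simp
  have P: "l * 2 > 0" using l_pos by simp
  have E: "{u \<in> Fp. eta u = 1} = {y. y ^ l = 1}"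
  proof (intro equalityI subsetI)
    fix y :: 'a assume "y \<in> {y. y ^ l = 1}"
    then have y: "y ^ l = 1" by simp
    then have "y \<in> Fp - {0}" unfolding G by (simp add: power_mult)
    then show "y \<in> {u \<in> Fp. eta u = 1}" using y by (simp add: eta_def)
  qed (auto simp: eta_def split: if_splits)
  show "u \<in> Fp \<and> eta u = 1 \<longleftrightarrow> u \<in> (\<lambda>c. c ^ 2) ` (Fp - {0})"
    using power_image_roots_of_unity(1)[OF G C P] E by blast
  show "card {u \<in> Fp. eta u = 1} = l"
    unfolding E by (rule power_image_roots_of_unity(2)[OF G C P])
qed

lemma card_eta_eq:
  assumes "k = 1 \<or> k = - 1"
  shows "card {u \<in> Fp. eta u = k} = l"
proof (cases "k = 1")
  case True then show ?thesis by (simp only: card_eta_eq_1)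
next
  case False
  have "{u \<in> Fp. eta u = k} = (Fp - {0}) - {u \<in> Fp. eta u = 1}"
    using False assms by (auto simp: eta_def)
  also have "card \<dots> = card (Fp - {0}) - card {u \<in> Fp. eta u = 1}"
    by (intro card_Diff_subset) (auto simp: eta_def)
  also have "\<dots> = l" unfolding card_eta_eq_1 using card_Fp p_eq by simp
  finally show ?thesis .
qed

text \<open>On nonzero arguments \<open>1 + k * eta u\<close> is twice the indicator of the class
  \<open>k\<close>; \<open>f 0\<close> is removed because the sums over \<open>Fp\<close> include
  zero.\<close>

lemma sum_eta_eq:
  fixes f :: "'a \<Rightarrow> int"
  assumes "k = 1 \<or> k = - 1"
  shows "2 * (\<Sum>u\<in>{u \<in> Fp. eta u = k}. f u) = (\<Sum>u\<in>Fp. f u) - f 0 + k * (\<Sum>u\<in>Fp. eta u * f u)"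
proof -
  have "2 * (\<Sum>u\<in>{u \<in> Fp. eta u = k}. f u) = (\<Sum>u\<in>{u \<in> Fp. eta u = k}. (1 + k * eta u) * f u)"
    unfolding sum_distrib_left using assms by (intro sum.cong) auto
  also have "\<dots> = (\<Sum>u\<in>Fp - {0}. (1 + k * eta u) * f u)"
    using assms by (intro sum.mono_neutral_left) (auto simp: eta_def split: if_splits)
  also have "\<dots> = (\<Sum>u\<in>Fp - {0}. f u) + k * (\<Sum>u\<in>Fp - {0}. eta u * f u)"
    by (simp add: distrib_right sum.distrib sum_distrib_left mult.assoc)
  also have "\<dots> = (\<Sum>u\<in>Fp. f u) - f 0 + k * (\<Sum>u\<in>Fp. eta u * f u)"
    unfolding sum_Fp by simp
  finally show ?thesis .
qed

lemma sum_eta: "(\<Sum>u\<in>Fp. eta u) = 0"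
  using sum_eta_eq[of 1 "\<lambda>_. 1"] card_eta_eq[of 1] card_Fp p_eq by simp

lemma sum_Fp_affine:
  assumes "a \<in> Fp" "a \<noteq> 0" "b \<in> Fp"
  shows "(\<Sum>u\<in>Fp. f (a * u + b)) = (\<Sum>u\<in>Fp. f u)"
  by (rule sum.reindex_bij_witness[of _ "\<lambda>u. (u - b) / a" "\<lambda>u. a * u + b"]) (use assms in auto)

lemma sum_eta_affine:
  assumes "a \<in> Fp" "a \<noteq> 0" "b \<in> Fp"
  shows "(\<Sum>u\<in>Fp. eta (a * u + b)) = 0"
  using sum_Fp_affine[OF assms, of eta] by (simp add: sum_eta)

text \<open>For nonzero \<open>u\<close>, \<open>u ^ 2 - u\<close> is
  \<open>u ^ 2 * (1 - 1 / u)\<close>. Inverting \<open>u\<close> leaves an affine sum that would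
  vanish over all of \<open>Fp\<close> but lacks its term \<open>eta 1\<close>.\<close>

lemma sum_eta_quadratic: "(\<Sum>u\<in>Fp. eta (u ^ 2 - u)) = - 1"
proof -
  have "(\<Sum>u\<in>Fp. eta (u ^ 2 - u)) = (\<Sum>u\<in>Fp - {0}. eta (u ^ 2 - u))"
    unfolding sum_Fp by simp
  also have "\<dots> = (\<Sum>u\<in>Fp - {0}. eta (1 - u))"
  proof (rule sum.reindex_bij_witness[of _ "\<lambda>u. 1 / u" "\<lambda>u. 1 / u"])
    fix u assume u: "u \<in> Fp - {0}"
    have "u ^ 2 - u = u ^ 2 * (1 - 1 / u)" using u by (simp add: field_simps power2_eq_square)
    then show "eta (1 - 1 / u) = eta (u ^ 2 - u)"
      using eta_square_mult[of u "1 - 1 / u"] Fp_diff[OF Fp_1 Fp_divide[OF Fp_1, of u]] u by auto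
  qed auto
  also have "\<dots> = (\<Sum>u\<in>Fp. eta ((- 1) * u + 1)) - 1"
    unfolding sum_Fp by simp
  also have "\<dots> = - 1"
    by (subst sum_eta_affine) auto
  finally show ?thesis .
qed

text \<open>The substitution \<open>s = 2 * u - 1\<close> turns \<open>s ^ 2 - 1\<close> into
  \<open>4 * (u ^ 2 - u)\<close>.\<close>

lemma sum_eta_square_minus_1: "(\<Sum>s\<in>Fp. eta (s ^ 2 - 1)) = - 1"
proof -
  have "(\<Sum>s\<in>Fp. eta (s ^ 2 - 1)) = (\<Sum>u\<in>Fp. eta ((2 * u + (- 1)) ^ 2 - 1))"
    by (rule sum_Fp_affine[of 2 "- 1", symmetric]) auto
  also have "\<dots> = (\<Sum>u\<in>Fp. eta (u ^ 2 - u))"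
  proof (rule sum.cong[OF refl])
    fix u assume u: "u \<in> Fp"
    have "(2 * u + (- 1)) ^ 2 - 1 = 2 ^ 2 * (u ^ 2 - u)"
      by (simp add: power2_eq_square algebra_simps)
    then show "eta ((2 * u + (- 1)) ^ 2 - 1) = eta (u ^ 2 - u)"
      using eta_square_mult[of 2 "u ^ 2 - u"] u by auto
  qed
  finally show ?thesis by (simp add: sum_eta_quadratic)
qed

lemma card_square_roots_1: "card {s \<in> Fp. s ^ 2 - 1 = 0} = 2"
proof -
  have "{s \<in> Fp. s ^ 2 - 1 = 0} = {1, - 1}"
    using Fp_uminus[of 1] by (auto simp: power2_eq_1_iff)
  then show ?thesis using one_neq_minus_one by simp
qed

end

context trace_code
begin

section \<open>Level sets on affine hyperplanes\<close>

definition slice :: "'a \<Rightarrow> 'a \<Rightarrow> 'a \<Rightarrow> int" where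
  "slice b s t = int (card {y. Q y = t \<and> B b y = s})"

text \<open>Translation by \<open>c * b\<close> changes \<open>s\<close> and \<open>t\<close> but
  preserves the discriminant \<open>s ^ 2 - 4 * Q b * t\<close>.\<close>

lemma slice_translate:
  assumes "c \<in> Fp"
  shows "slice b s t = slice b (s + 2 * c * Q b) (t + c * s + c ^ 2 * Q b)"
proof -
  have Bc: "B b (y + c * b) = B b y + 2 * c * Q b" for y
    by (simp add: B_add B_scale[OF assms] B_self)
  have Qc: "Q (y + c * b) = Q y + c * B b y + c ^ 2 * Q b" for y
    by (simp add: Q_add Q_scale[OF assms] B_scale[OF assms] B_commute[of b])
  have "bij_betw (\<lambda>y. y + c * b) {y. Q y = t \<and> B b y = s}
    {y. Q y = t + c * s + c ^ 2 * Q b \<and> B b y = s + 2 * c * Q b}"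
  proof (rule bij_betw_byWitness[where f' = "\<lambda>y. y - c * b"])
    show "(\<lambda>y. y - c * b) ` {y. Q y = t + c * s + c ^ 2 * Q b \<and> B b y = s + 2 * c * Q b}
      \<subseteq> {y. Q y = t \<and> B b y = s}"
    proof safe
      fix y assume y: "Q y = t + c * s + c ^ 2 * Q b" "B b y = s + 2 * c * Q b"
      show "B b (y - c * b) = s" using Bc[of "y - c * b"] y by simp
      then show "Q (y - c * b) = t" using Qc[of "y - c * b"] y by simp
    qed
  qed (auto simp: Bc Qc)
  then show ?thesis unfolding slice_def by (simp add: bij_betw_same_card)
qed

lemma slice_scale:
  assumes "c \<in> Fp" "c \<noteq> 0"
  shows "slice b (c * s) (c ^ 2 * t) = slice b s t"
proof -
  have Bc: "B b (c * y) = c * B b y" for y by (rule B_scale[OF assms(1)])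
  have Qc: "Q (c * y) = c ^ 2 * Q y" for y by (rule Q_scale[OF assms(1)])
  have "bij_betw (\<lambda>y. c * y) {y. Q y = t \<and> B b y = s} {y. Q y = c ^ 2 * t \<and> B b y = c * s}"
  proof (rule bij_betw_byWitness[where f' = "\<lambda>y. y / c"])
    show "(\<lambda>y. y / c) ` {y. Q y = c ^ 2 * t \<and> B b y = c * s} \<subseteq> {y. Q y = t \<and> B b y = s}"
    proof safe
      fix y assume y: "Q y = c ^ 2 * t" "B b y = c * s"
      show "B b (y / c) = s" using Bc[of "y / c"] y assms(2) by simp
      show "Q (y / c) = t" using Qc[of "y / c"] y assms(2) by simp
    qed
  qed (use assms(2) in \<open>auto simp: Bc Qc\<close>)
  then show ?thesis unfolding slice_def by (simp add: bij_betw_same_card)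
qed

lemma sum_slice_hyperplanes: "(\<Sum>s\<in>Fp. slice b s t) = level t"
  using card_eq_sum_fibers[of "{y. Q y = t}" Fp "B b"] by (simp add: slice_def level_def)

lemma sum_slice_levels:
  assumes "b \<noteq> 0" "s \<in> Fp"
  shows "(\<Sum>t\<in>Fp. slice b s t) = int p ^ (e - 1)"
  using card_eq_sum_fibers[of "{y. B b y = s}" Fp Q] card_B_fiber[OF assms]
  by (simp add: slice_def conj_commute)

lemma p_power_e_minus_1: "int p ^ (e - 1) = int p * int p ^ (e - 2)"
proof -
  have "e - 1 = Suc (e - 2)" using e_mod by (cases "e \<ge> 2") (auto simp: not_le less_2_cases_iff)
  then show ?thesis by simp
qed

text \<open>For isotropic \<open>b\<close>, translation by \<open>c * b\<close> fixes
  \<open>s\<close> and moves \<open>t\<close> by \<open>c * s\<close>, so all levels meet the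
  hyperplane equally often.\<close>

lemma slice_isotropic_nonzero:
  assumes "b \<noteq> 0" "Q b = 0" "s \<in> Fp" "s \<noteq> 0" "t \<in> Fp"
  shows "slice b s t = int p ^ (e - 2)"
proof -
  have const: "slice b s u = slice b s 0" if "u \<in> Fp" for u
    using slice_translate[OF Fp_divide[OF that assms(3)], of b s 0] assms by simp
  have "int p * slice b s 0 = (\<Sum>u\<in>Fp. slice b s 0)" by (simp add: card_Fp)
  also have "\<dots> = (\<Sum>u\<in>Fp. slice b s u)" by (rule sum.cong[OF refl const[symmetric]])
  also have "\<dots> = int p * int p ^ (e - 2)"
    using sum_slice_levels[OF assms(1,3)] p_power_e_minus_1 by simp
  finally have "slice b s 0 = int p ^ (e - 2)" using p_ge_3 by simp
  then show ?thesis using const[OF assms(5)] by simp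
qed

text \<open>The parallel hyperplanes with \<open>s\<close> nonzero are already counted; subtracting
  them from the whole level leaves this one.\<close>

lemma slice_isotropic_0:
  assumes "b \<noteq> 0" "Q b = 0" "t \<in> Fp" "t \<noteq> 0"
  shows "slice b 0 t = int p ^ (e - 2) + int h"
proof -
  have "level t = slice b 0 t + (\<Sum>s\<in>Fp - {0}. slice b s t)"
    using sum_slice_hyperplanes[of b t] by (simp add: sum_Fp)
  also have "(\<Sum>s\<in>Fp - {0}. slice b s t) = (\<Sum>s\<in>Fp - {0}. int p ^ (e - 2))"
    using assms by (intro sum.cong) (auto intro: slice_isotropic_nonzero)
  also have "\<dots> = (int p - 1) * int p ^ (e - 2)"
    using p_ge_3 by (simp add: card_Fp of_nat_diff)
  finally show ?thesis
    using level_1 level_eq_level_1[OF assms(3,4)] p_power_e_minus_1 by (simp add: algebra_simps)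
qed

text \<open>Translating along \<open>b\<close> shows that the count depends only on the discriminant
  \<open>s\<^sup>2 - 4 r t\<close>, and scaling that it depends only on its square class. The three unknown
  values are then determined by three linear relations.\<close>

lemma slice_anisotropic:
  assumes r: "Q b \<noteq> 0" and "s \<in> Fp" "t \<in> Fp"
  shows "slice b s t = int p ^ (e - 2) - int h * eta (s ^ 2 - 4 * Q b * t)"
proof -
  have b: "b \<noteq> 0" using r by auto
  \<comment> \<open>The argument of \<open>F\<close> is the discriminant: at \<open>s = 0\<close>
    the level \<open>- u / (4 * Q b)\<close> has discriminant \<open>u\<close>.\<close>
  define F where "F u = slice b 0 (- u / (4 * Q b))" for u
  have MF: "slice b s t = F (s ^ 2 - 4 * Q b * t)" if "s \<in> Fp" for s t
  proof -
    \<comment> \<open>Translation by this multiple of \<open>b\<close> moves the hyperplane to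
      \<open>s = 0\<close>.\<close>
    define c where "c = - s / (2 * Q b)"
    have c: "c \<in> Fp" unfolding c_def using that by (intro Fp_divide Fp_uminus Fp_mult) auto
    have 1: "s + 2 * c * Q b = 0" using r by (simp add: c_def)
    then have s: "s = - (2 * c * Q b)" by (simp add: eq_neg_iff_add_eq_0)
    have 2: "t + c * s + c ^ 2 * Q b = - (s ^ 2 - 4 * Q b * t) / (4 * Q b)"
      using r unfolding s by (subst eq_divide_eq) (simp add: algebra_simps power2_eq_square)
    show ?thesis using slice_translate[OF c, of b s t] unfolding 1 2 F_def .
  qed
  have F_square: "F (c ^ 2 * u) = F u" if "c \<in> Fp" "c \<noteq> 0" for c u
    using slice_scale[OF that, of b 0 "- u / (4 * Q b)"] by (simp add: F_def)
  have "card {u \<in> Fp. eta u = - 1} > 0" using card_eta_eq[of "- 1"] l_pos by simp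
  then obtain g where g: "g \<in> Fp" "eta g = - 1" by (auto simp: card_gt_0_iff)
  then have g0: "g \<noteq> 0" by auto
  have F1: "F u = F 1" if u: "u \<in> Fp" "eta u = 1" for u
  proof -
    obtain c where "c \<in> Fp" "c \<noteq> 0" "u = c ^ 2" using u eta_eq_1_iff[of u] by auto
    then show ?thesis using F_square[of c 1] by simp
  qed
  have Fg: "F u = F g" if u: "u \<in> Fp" "eta u = - 1" for u
  proof -
    have "u / g \<in> Fp" using u g by auto
    moreover have "eta (u / g) * eta g = eta u" using eta_mult[OF \<open>u / g \<in> Fp\<close> g(1)] g0 by simp
    then have "eta (u / g) = 1" using u g by simp
    ultimately obtain c where "c \<in> Fp" "c \<noteq> 0" "u / g = c ^ 2" using eta_eq_1_iff[of "u / g"] by auto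
    then show ?thesis using F_square[of c g] g0 by (simp add: field_simps)
  qed
  \<comment> \<open>On \<open>Fp\<close>, \<open>F\<close> takes only the values \<open>F 0\<close>,
    \<open>F 1\<close> and \<open>F g\<close>; \<open>E\<close> measures how far
    \<open>2 * F 0\<close> departs from the pattern \<open>S + D * eta u\<close>.\<close>
  define S where "S = F 1 + F g"
  define D where "D = F 1 - F g"
  define E where "E = 2 * F 0 - S"
  have F: "2 * F u = S + D * eta u + (if u = 0 then E else 0)" if "u \<in> Fp" for u
  proof (cases "u = 0")
    case False
    from that False show ?thesis
    proof (cases rule: eta_cases)
      case 1
      then show ?thesis using F1[OF that 1] False by (simp add: S_def D_def)
    next
      case 2
      then show ?thesis using Fg[OF that 2] False by (simp add: S_def D_def)
    qed
  qed (simp add: E_def)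
  have sumF: "2 * (\<Sum>s\<in>Fp. F (f s)) = int p * S + D * (\<Sum>s\<in>Fp. eta (f s)) + E * int (card {s \<in> Fp. f s = 0})"
    if f: "\<And>s. s \<in> Fp \<Longrightarrow> f s \<in> Fp" for f
  proof -
    have "2 * (\<Sum>s\<in>Fp. F (f s)) = (\<Sum>s\<in>Fp. S + D * eta (f s) + (if f s = 0 then E else 0))"
      unfolding sum_distrib_left by (intro sum.cong refl F f)
    also have "(\<Sum>s\<in>Fp. if f s = 0 then E else 0) = E * int (card {s \<in> Fp. f s = 0})"
      by (simp add: sum.If_cases Int_def)
    ultimately show ?thesis by (simp add: sum.distrib card_Fp sum_distrib_left)
  qed
  \<comment> \<open>First relation: at \<open>t = 0\<close> the discriminants are squares.\<close>
  have "(\<Sum>s\<in>Fp. F (s ^ 2)) = level 0"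
    using sum_slice_hyperplanes[of b 0] by (simp add: MF cong: sum.cong)
  moreover have "(\<Sum>s\<in>Fp. eta (s ^ 2)) = int p - 1"
  proof -
    have "(\<Sum>s\<in>Fp. eta (s ^ 2)) = (\<Sum>s\<in>Fp - {0}. 1)"
      unfolding sum_Fp by (auto intro!: sum.cong simp: eta_square)
    then show ?thesis using p_ge_3 by (simp add: card_Fp of_nat_diff)
  qed
  moreover have "{s \<in> Fp. s ^ 2 = 0} = {0}" by auto
  ultimately have e1: "int p * S + D * (int p - 1) + E = 2 * level 0"
    using sumF[of "\<lambda>s. s ^ 2", OF Fp_power] by auto
  \<comment> \<open>Second relation: the level \<open>1 / (4 * Q b)\<close> makes the discriminant
    \<open>s ^ 2 - 1\<close>.\<close>
  have rr: "1 / (4 * Q b) \<in> Fp" "1 / (4 * Q b) \<noteq> 0" using r by (auto intro!: Fp_divide Fp_mult)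
  have "(\<Sum>s\<in>Fp. F (s ^ 2 - 1)) = level (1 / (4 * Q b))"
    using sum_slice_hyperplanes[of b "1 / (4 * Q b)"] r by (simp add: MF cong: sum.cong)
  then have e2: "int p * S - D + E * 2 = 2 * level 1"
    using sumF[of "\<lambda>s. s ^ 2 - 1", OF Fp_diff[OF Fp_power Fp_1]] level_eq_level_1[OF rr] sum_eta_square_minus_1 card_square_roots_1 by auto
  \<comment> \<open>Third relation: on the hyperplane \<open>s = 0\<close> the discriminant runs
    once through \<open>Fp\<close>.\<close>
  have "(\<Sum>t\<in>Fp. F ((- 4 * Q b) * t + 0)) = int p ^ (e - 1)"
    using sum_slice_levels[OF b, of 0] by (simp add: MF)
  moreover have "(\<Sum>t\<in>Fp. F ((- 4 * Q b) * t + 0)) = (\<Sum>u\<in>Fp. F u)"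
    using r Fp_uminus[OF Fp_mult[OF Fp_numeral Q_in_Fp]] by (intro sum_Fp_affine) auto
  moreover have "{s \<in> Fp. s = 0} = {0}" by auto
  ultimately have e3: "int p * S + E = 2 * int p ^ (e - 1)"
    using sumF[of "\<lambda>u. u"] by (simp add: sum_eta)
  have "(int p - 1) * D = (int p - 1) * (- 2 * int h)"
    using e1 e3 level_0 by (simp add: algebra_simps)
  moreover have "int p - 1 \<noteq> 0" using p_ge_3 by simp
  ultimately have D: "D = - 2 * int h" by (metis mult_cancel_left)
  then have E: "E = 0" using e2 e3 level_1 by simp
  then have "int p * S = int p * (2 * int p ^ (e - 2))" using e3 p_power_e_minus_1 by simp
  then have S: "S = 2 * int p ^ (e - 2)" using p_ge_3 by simp
  have "s ^ 2 - 4 * Q b * t \<in> Fp" using assms by (intro Fp_diff Fp_mult Fp_power) auto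
  from F[OF this, unfolded E] show ?thesis using MF[OF assms(2), of t] by (simp add: D S)
qed

end

section \<open>Hyperplane counts by square class\<close>

context trace_code
begin

definition char_slice :: "int \<Rightarrow> 'a \<Rightarrow> 'a \<Rightarrow> int" where
  "char_slice k b s = int (card {y. eta (Q y) = k \<and> B b y = s})"

lemma char_slice_eq_sum: "char_slice k b s = (\<Sum>t\<in>{u \<in> Fp. eta u = k}. slice b s t)"
proof -
  have "char_slice k b s = (\<Sum>t\<in>{u \<in> Fp. eta u = k}. int (card {y \<in> {y. eta (Q y) = k \<and> B b y = s}. Q y = t}))"
    unfolding char_slice_def by (rule card_eq_sum_fibers) auto
  also have "\<dots> = (\<Sum>t\<in>{u \<in> Fp. eta u = k}. slice b s t)"
    unfolding slice_def by (intro sum.cong refl arg_cong[where f = "\<lambda>A. int (card A)"]) auto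
  finally show ?thesis .
qed

lemma card_eta_Q:
  assumes "k = 1 \<or> k = - 1"
  shows "int (card {y. eta (Q y) = k}) = int l * (int p ^ (e - 1) + int h)"
proof -
  have "int (card {y. eta (Q y) = k})
      = (\<Sum>t\<in>{u \<in> Fp. eta u = k}. int (card {y \<in> {y. eta (Q y) = k}. Q y = t}))"
    by (rule card_eq_sum_fibers) auto
  also have "\<dots> = (\<Sum>t\<in>{u \<in> Fp. eta u = k}. level 1)"
  proof (intro sum.cong refl)
    fix t assume t: "t \<in> {u \<in> Fp. eta u = k}"
    then have "{y \<in> {y. eta (Q y) = k}. Q y = t} = {y. Q y = t}" by auto
    moreover have "t \<noteq> 0" using t assms by auto
    ultimately show "int (card {y \<in> {y. eta (Q y) = k}. Q y = t}) = level 1"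
      using level_eq_level_1[of t] t by (simp add: level_def)
  qed
  also have "\<dots> = int l * (int p ^ (e - 1) + int h)"
    unfolding sum_constant card_eta_eq[OF assms] level_1 by simp
  finally show ?thesis .
qed

text \<open>Substituting \<open>t = s ^ 2 / (4 * r) * u\<close> reduces the twisted sum to
  \<open>sum_eta_quadratic\<close>; the summand \<open>- 1\<close> comes from the excluded
  \<open>t = 0\<close>, where \<open>eta (s ^ 2) = 1\<close>.\<close>

lemma sum_eta_discriminant:
  assumes k: "k = 1 \<or> k = - 1" and r: "r \<in> Fp" "r \<noteq> 0" and s: "s \<in> Fp" "s \<noteq> 0"
  shows "2 * (\<Sum>t\<in>{u \<in> Fp. eta u = k}. eta (s ^ 2 - 4 * r * t)) = - 1 - k * eta (- r)"
proof -
  have 4: "4 * r \<in> Fp" "4 * r \<noteq> 0" using r by auto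
  have aff: "(\<Sum>t\<in>Fp. eta (s ^ 2 - 4 * r * t)) = 0"
    using sum_eta_affine[of "- (4 * r)" "s ^ 2"] Fp_uminus[OF 4(1)] 4(2) Fp_power[OF s(1)]
    by simp
  let ?a = "s ^ 2 / (4 * r)"
  have a: "?a \<in> Fp" "?a \<noteq> 0" using Fp_divide[OF Fp_power[OF s(1)] 4(1)] 4 s by auto
  have "(\<Sum>t\<in>Fp. eta t * eta (s ^ 2 - 4 * r * t)) = (\<Sum>u\<in>Fp. eta (?a * u + 0) * eta (s ^ 2 - 4 * r * (?a * u + 0)))"
    by (rule sum_Fp_affine[OF a Fp_0, symmetric])
  also have "\<dots> = (\<Sum>u\<in>Fp. eta (- r) * eta (u ^ 2 - u))"
  proof (intro sum.cong refl)
    fix u assume u: "u \<in> Fp"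
    \<comment> \<open>Chosen so that \<open>?c ^ 2 * r = ?a * s ^ 2\<close>; this exhibits the
      square factor that \<open>eta\<close> ignores.\<close>
    let ?c = "s ^ 2 / (2 * r)"
    have au: "?a * u \<in> Fp" by (rule Fp_mult[OF a(1) u])
    have c: "?c \<in> Fp" "?c \<noteq> 0" using r s by (auto intro!: Fp_divide)
    have uu: "u ^ 2 - u \<in> Fp" using u by auto
    have "s ^ 2 - 4 * r * (?a * u) \<in> Fp"
      by (rule Fp_diff[OF Fp_power[OF s(1)] Fp_mult[OF 4(1) au]])
    then have "eta (?a * u) * eta (s ^ 2 - 4 * r * (?a * u)) = eta (?a * u * (s ^ 2 - 4 * r * (?a * u)))"
      using eta_mult[OF au] by simp
    also have "?a * u * (s ^ 2 - 4 * r * (?a * u)) = ?c ^ 2 * ((- r) * (u ^ 2 - u))"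
    proof -
      have 1: "4 * r * (?a * u) = s ^ 2 * u" using 4(2) by simp
      have "?c ^ 2 * r = ?a * s ^ 2"
      proof -
        have "(2 * r) ^ 2 = 4 * r * r" by (simp add: power2_eq_square)
        then have "?c ^ 2 * r = (s ^ 2) ^ 2 * r / (4 * r * r)" by (simp only: power_divide) simp
        then show ?thesis using r by (simp add: power2_eq_square)
      qed
      then have 2: "?c ^ 2 * ((- r) * (u ^ 2 - u)) = - (?a * s ^ 2) * (u ^ 2 - u)"
        by (metis mult.assoc mult_minus_right)
      have "x * u * (y - y * u) = - (x * y) * (u ^ 2 - u)" for x y
        by (simp add: algebra_simps power2_eq_square)
      then show ?thesis unfolding 1 2 .
    qed
    also have "eta \<dots> = eta (- r) * eta (u ^ 2 - u)"
      using eta_square_mult[OF c] eta_mult[OF Fp_uminus[OF r(1)] uu]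
        Fp_mult[OF Fp_uminus[OF r(1)] uu] by metis
    finally show "eta (?a * u + 0) * eta (s ^ 2 - 4 * r * (?a * u + 0)) = eta (- r) * eta (u ^ 2 - u)"
      by simp
  qed
  also have "\<dots> = - eta (- r)"
    by (simp add: sum_eta_quadratic flip: sum_distrib_left)
  finally show ?thesis
    using sum_eta_eq[OF k, of "\<lambda>t. eta (s ^ 2 - 4 * r * t)"] aff eta_square[OF s] by simp
qed

text \<open>One formula covers every nonzero \<open>b\<close>: if \<open>Q b = 0\<close>, the test
  \<open>k * eta (- Q b) = 1\<close> fails, and the isotropic counts agree with that branch.\<close>

lemma char_slice_eq:
  assumes k: "k = 1 \<or> k = - 1" and b: "b \<noteq> 0" and s: "s \<in> Fp"
  shows "char_slice k b s = int l * int p ^ (e - 2)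
    + (if s = 0 then (if k * eta (- Q b) = 1 then - int l else int l)
       else (if k * eta (- Q b) = 1 then 1 else 0)) * int h"
proof (cases "Q b = 0")
  case True
  show ?thesis
  proof (cases "s = 0")
    case s0: True
    have "char_slice k b s = (\<Sum>t\<in>{u \<in> Fp. eta u = k}. int p ^ (e - 2) + int h)"
      unfolding char_slice_eq_sum s0 using k by (intro sum.cong refl slice_isotropic_0 b True) auto
    then show ?thesis unfolding sum_constant card_eta_eq[OF k] using s0 True by (simp add: algebra_simps)
  next
    case s0: False
    have "char_slice k b s = (\<Sum>t\<in>{u \<in> Fp. eta u = k}. int p ^ (e - 2))"
      unfolding char_slice_eq_sum by (intro sum.cong refl slice_isotropic_nonzero b True s s0) auto
    then show ?thesis unfolding sum_constant card_eta_eq[OF k] using s0 True by simp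
  qed
next
  case False
  have ne: "eta (- Q b) = 1 \<or> eta (- Q b) = - 1"
    using eta_cases[of "- Q b"] False Fp_uminus[OF Q_in_Fp] by (metis neg_equal_0_iff_equal)
  have "char_slice k b s = (\<Sum>t\<in>{u \<in> Fp. eta u = k}. int p ^ (e - 2) - int h * eta (s ^ 2 - 4 * Q b * t))"
    unfolding char_slice_eq_sum by (intro sum.cong refl slice_anisotropic False s) auto
  also have "\<dots> = int l * int p ^ (e - 2) - int h * (\<Sum>t\<in>{u \<in> Fp. eta u = k}. eta (s ^ 2 - 4 * Q b * t))"
    unfolding sum_subtractf sum_constant card_eta_eq[OF k] by (simp add: sum_distrib_left)
  finally have G: "char_slice k b s = \<dots>" .
  show ?thesis
  proof (cases "s = 0")
    case True
    have "(\<Sum>t\<in>{u \<in> Fp. eta u = k}. eta (s ^ 2 - 4 * Q b * t)) = (\<Sum>t\<in>{u \<in> Fp. eta u = k}. k * eta (- Q b))"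
    proof (intro sum.cong refl)
      fix t assume t: "t \<in> {u \<in> Fp. eta u = k}"
      have "s ^ 2 - 4 * Q b * t = 2 ^ 2 * (- Q b * t)" using True by simp
      moreover have "- Q b * t \<in> Fp" using t by (intro Fp_mult Fp_uminus) auto
      ultimately have "eta (s ^ 2 - 4 * Q b * t) = eta (- Q b * t)"
        by (simp only: eta_square_mult[OF Fp_numeral two_neq_0])
      then show "eta (s ^ 2 - 4 * Q b * t) = k * eta (- Q b)"
        using eta_mult[OF Fp_uminus[OF Q_in_Fp], of t b] t by simp
    qed
    then show ?thesis unfolding G sum_constant card_eta_eq[OF k] using k ne True by auto
  next
    case s0: False
    then show ?thesis
      using G sum_eta_discriminant[OF k Q_in_Fp False s s0] k ne by auto
  qed
qed

section \<open>The code\<close>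

text \<open>The values \<open>k = 1\<close> and \<open>k = - 1\<close> give the two defining sets,
  for squares and nonsquares, so both codes are treated at once.\<close>

definition Dk :: "int \<Rightarrow> 'a set" where
  "Dk k = {x. eta (Tr (x ^ (p + 1) - x)) = k}"

text \<open>Indexing by \<open>b\<close> instead of the multiplier \<open>L b\<close> lets the
  weight be read off from \<open>B b\<close>, \<open>Q b\<close> and \<open>Tr b\<close>.\<close>

definition word :: "int \<Rightarrow> 'a \<Rightarrow> 'a \<Rightarrow> 'a" where
  "word k b = codeword p e (Dk k) (L b)"

definition Wt :: int where "Wt = 2 * int l ^ 2 * int p ^ (e - 2)"

definition X :: "int \<Rightarrow> 'a \<Rightarrow> bool" where "X k b \<longleftrightarrow> k * eta (- Q b) = 1"

lemma shift_image: "{x. P x} = (\<lambda>y. y + 1/2 :: 'a) ` {y. P (y + 1/2)}"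
proof -
  have "x \<in> (\<lambda>y. y + 1/2) ` {y. P (y + 1/2)}" if "P x" for x
    using that by (intro image_eqI[of _ _ "x - 1/2"]) auto
  then show ?thesis by auto
qed

lemma card_shift: "card {x. P x} = card {y. P (y + 1/2 :: 'a)}"
  by (subst shift_image) (simp add: card_image)

lemma card_Dk:
  assumes "k = 1 \<or> k = - 1"
  shows "int (card (Dk k)) = int l * (int p ^ (e - 1) + int h)"
  unfolding Dk_def by (subst card_shift) (simp only: tr_shift card_eta_Q[OF assms])

lemma hweight_word_0: "hweight (Dk k) (word k 0) = 0"
proof -
  have "L 0 = 0" by (simp add: L_eq_0_iff)
  then show ?thesis by (simp add: hweight_def word_def codeword_def)
qed

text \<open>The weight is the length minus the number of zero coordinates; after the shift by 1/2
  these zeros form a \<open>char_slice\<close> at \<open>s = - Tr b\<close>.\<close>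

lemma hweight_word:
  assumes k: "k = 1 \<or> k = - 1" and b: "b \<noteq> 0"
  shows "int (hweight (Dk k) (word k b)) = Wt
    + (if Tr b = 0 then (if X k b then 2 * int l else 0) else (if X k b then int l - 1 else int l)) * int h"
proof -
  have "hweight (Dk k) (word k b) = card {x. eta (Tr (x ^ (p + 1) - x)) = k \<and> Tr (L b * x) \<noteq> 0}"
    unfolding hweight_def word_def codeword_def Dk_def by (intro arg_cong[where f = card]) auto
  also have "\<dots> = card {y. eta (Q y) = k \<and> B b y + Tr b \<noteq> 0}"
    by (subst card_shift) (simp only: tr_shift tr_L_shift)
  also have "{y. eta (Q y) = k \<and> B b y + Tr b \<noteq> 0}
      = {y. eta (Q y) = k} - {y. eta (Q y) = k \<and> B b y = - Tr b}"
    by (auto simp: eq_neg_iff_add_eq_0)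
  also have "int (card \<dots>) = int (card {y. eta (Q y) = k}) - char_slice k b (- Tr b)"
    unfolding char_slice_def by (subst card_Diff_subset) (auto intro!: of_nat_diff card_mono)
  also have "\<dots> = int l * (int p ^ (e - 1) + int h) - char_slice k b (- Tr b)"
    by (simp only: card_eta_Q[OF k])
  also have "\<dots> = Wt + (if Tr b = 0 then (if X k b then 2 * int l else 0)
      else (if X k b then int l - 1 else int l)) * int h"
  proof -
    have "int p = 2 * int l + 1" using p_eq by linarith
    \<comment> \<open>The second summand cancels the main term of \<open>char_slice\<close>.\<close>
    then have "int l * int p ^ (e - 1) = Wt + int l * int p ^ (e - 2)"
      unfolding p_power_e_minus_1 Wt_def by (simp add: algebra_simps power2_eq_square)
    then show ?thesis
      using char_slice_eq[OF k b, of "- Tr b"] Fp_uminus[OF tr_in_Fp, of b] by (simp add: X_def algebra_simps)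
  qed
  finally show ?thesis .
qed

lemma Wt_pos: "Wt > 0"
  unfolding Wt_def using l_pos p_ge_3 by simp

text \<open>Since \<open>l\<close> is at least 1, no coefficient of \<open>h\<close> is negative.
  Positivity makes \<open>word k\<close> injective, which gives the dimension.\<close>

lemma hweight_word_pos:
  assumes k: "k = 1 \<or> k = - 1" and b: "b \<noteq> 0"
  shows "hweight (Dk k) (word k b) > 0"
proof -
  have "1 \<le> int l" using l_pos by linarith
  then have "0 \<le> (if Tr b = 0 then (if X k b then 2 * int l else 0) else (if X k b then int l - 1 else int l))"
    by (cases "Tr b = 0"; cases "X k b") simp_all
  then have "int (hweight (Dk k) (word k b)) \<ge> Wt" unfolding hweight_word[OF k b] by simp
  then show ?thesis using Wt_pos by linarith
qed

lemma word_diff: "word k (x - y) = (\<lambda>z. word k x z - word k y z)"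
proof -
  have "L x = L (x - y) + L y" by (simp flip: L_add)
  then have "L (x - y) = L x - L y" by simp
  then show ?thesis by (auto simp: word_def codeword_def left_diff_distrib tr_diff)
qed

lemma inj_word:
  assumes k: "k = 1 \<or> k = - 1"
  shows "inj (word k)"
proof (rule injI)
  fix x y assume "word k x = word k y"
  then have "hweight (Dk k) (word k (x - y)) = 0" by (simp add: word_diff hweight_def)
  then show "x = y" using hweight_word_pos[OF k, of "x - y"] by auto
qed

lemma code_eq: "code p e (Dk k) = range (word k)"
proof -
  have "code p e (Dk k) = codeword p e (Dk k) ` range L"
    unfolding code_def using bij_L by (auto simp: bij_def)
  then show ?thesis by (simp add: word_def image_image)
qed

text \<open>Up to the sign \<open>eta (- 1)\<close>, \<open>X\<close> prescribes the square class of
  \<open>Q b\<close>. The trace-zero hyperplane belongs to the isotropic vector \<open>1\<close>, so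
  the second count is a \<open>char_slice\<close>.\<close>

lemma card_X:
  assumes k: "k = 1 \<or> k = - 1"
  shows "int (card {b. X k b}) = int l * (int p ^ (e - 1) + int h)"
    and "int (card {b. Tr b = 0 \<and> X k b}) = int l * (int p ^ (e - 2) + int h)"
proof -
  define k' where "k' = k * eta (- 1)"
  have "eta (- 1) = 1 \<or> eta (- 1) = - 1"
    using eta_cases[OF Fp_uminus[OF Fp_1]] by (metis neg_equal_0_iff_equal zero_neq_one)
  then have k': "k' = 1 \<or> k' = - 1" and kk: "k * eta (- 1) * t = 1 \<longleftrightarrow> t = k'" for t
    using k by (auto simp: k'_def)
  have Xk': "X k b \<longleftrightarrow> eta (Q b) = k'" for b
    using eta_mult[OF Fp_uminus[OF Fp_1] Q_in_Fp, of b] kk[of "eta (Q b)"]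
    by (simp add: X_def mult.assoc)
  show "int (card {b. X k b}) = int l * (int p ^ (e - 1) + int h)"
    unfolding Xk' by (rule card_eta_Q[OF k'])
  have "{b. Tr b = 0 \<and> X k b} = {b. eta (Q b) = k' \<and> B 1 b = 0}"
    by (auto simp: Xk' B_commute[of 1] B_one)
  then show "int (card {b. Tr b = 0 \<and> X k b}) = int l * (int p ^ (e - 2) + int h)"
    using char_slice_eq[OF k', of 1 0] by (simp add: char_slice_def Q_one algebra_simps)
qed

text \<open>The field splits by \<open>Tr b = 0\<close> and \<open>X k b\<close>, with
  \<open>b = 0\<close> set apart. Adding conditional terms stays correct when weights coincide, as
  \<open>Wt\<close> and \<open>Wt + (l - 1) * h\<close> do for \<open>p = 3\<close>.\<close>

lemma card_hweight_word:
  assumes k: "k = 1 \<or> k = - 1"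
  shows "int (card {b. int (hweight (Dk k) (word k b)) = w})
    = (if 0 = w then 1 else 0)
    + (if Wt = w then (int l + 1) * int p ^ (e - 2) - 1 - int l * int h else 0)
    + (if Wt + int l * int h = w then 2 * int l * (int l + 1) * int p ^ (e - 2) else 0)
    + (if Wt + 2 * int l * int h = w then int l * int p ^ (e - 2) + int l * int h else 0)
    + (if Wt + (int l - 1) * int h = w then 2 * int l ^ 2 * int p ^ (e - 2) else 0)"
proof -
  let ?wt = "\<lambda>b. int (hweight (Dk k) (word k b))"
  let ?g = "\<lambda>v. if v = w then 1 else 0 :: int"
  let ?TX = "{b. Tr b = 0 \<and> X k b}" and ?T = "{b. Tr b = 0 \<and> \<not> X k b} - {0}"
    and ?X = "{b. Tr b \<noteq> 0 \<and> X k b}" and ?N = "{b. Tr b \<noteq> 0 \<and> \<not> X k b}"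
  have X0: "\<not> X k 0" by (simp add: X_def)
  have p: "int p = 2 * int l + 1" using p_eq by linarith
  have cT: "card {b. Tr b = 0} = p ^ (e - 1)" using card_tr_fiber[of 1 0] by simp
  have TX: "int (card ?TX) = int l * (int p ^ (e - 2) + int h)" by (rule card_X(2)[OF k])
  have "{b. Tr b = 0} = insert 0 (?T \<union> ?TX)" by auto
  also have "card \<dots> = Suc (card (?T \<union> ?TX))" using X0 by simp
  also have "card (?T \<union> ?TX) = card ?T + card ?TX" by (rule card_Un_disjoint) auto
  finally have T: "int (card ?T) = int p ^ (e - 1) - 1 - int (card ?TX)"
    using cT by (simp flip: of_nat_power)
  have "{b. X k b} = ?TX \<union> ?X" by auto
  also have "card \<dots> = card ?TX + card ?X" by (rule card_Un_disjoint) auto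
  finally have cX: "int (card ?X) = int l * (int p ^ (e - 1) + int h) - int (card ?TX)"
    using card_X(1)[OF k] by linarith
  have "UNIV = {b. Tr b = 0} \<union> (?X \<union> ?N)" by auto
  then have "card (UNIV :: 'a set) = card ({b. Tr b = 0} \<union> (?X \<union> ?N))" by (rule arg_cong)
  also have "\<dots> = card {b. Tr b = 0} + card (?X \<union> ?N)" by (rule card_Un_disjoint) auto
  also have "card (?X \<union> ?N) = card ?X + card ?N" by (rule card_Un_disjoint) auto
  finally have cN: "int (card ?N) = int p ^ e - int p ^ (e - 1) - int (card ?X)"
    using cT card by (simp flip: of_nat_power)
  have pe: "int p ^ e = int p * int p ^ (e - 1)" using e_pos by (metis power_eq_if not_gr_zero)
  have "int (card {b. ?wt b = w}) = (\<Sum>b\<in>UNIV. ?g (?wt b))"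
    by (simp add: sum.If_cases)
  also have "(UNIV :: 'a set) = insert 0 ((?T \<union> ?TX) \<union> (?X \<union> ?N))" by auto
  also have "(\<Sum>b\<in>\<dots>. ?g (?wt b)) = ?g 0 + (\<Sum>b\<in>(?T \<union> ?TX) \<union> (?X \<union> ?N). ?g (?wt b))"
    using X0 by (subst sum.insert) (auto simp: hweight_word_0)
  also have "(\<Sum>b\<in>(?T \<union> ?TX) \<union> (?X \<union> ?N). ?g (?wt b))
      = (\<Sum>b\<in>?T. ?g (?wt b)) + (\<Sum>b\<in>?TX. ?g (?wt b)) + ((\<Sum>b\<in>?X. ?g (?wt b)) + (\<Sum>b\<in>?N. ?g (?wt b)))"
    by (subst sum.union_disjoint, simp, simp, blast)+ (rule refl)
  also have "(\<Sum>b\<in>?T. ?g (?wt b)) = (\<Sum>b\<in>?T. ?g Wt)"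
    by (intro sum.cong refl) (auto simp: hweight_word[OF k])
  also have "(\<Sum>b\<in>?TX. ?g (?wt b)) = (\<Sum>b\<in>?TX. ?g (Wt + 2 * int l * int h))"
  proof (intro sum.cong refl)
    fix b assume "b \<in> ?TX"
    moreover then have "b \<noteq> 0" using X0 by auto
    ultimately show "?g (?wt b) = ?g (Wt + 2 * int l * int h)" by (simp add: hweight_word[OF k])
  qed
  also have "(\<Sum>b\<in>?X. ?g (?wt b)) = (\<Sum>b\<in>?X. ?g (Wt + (int l - 1) * int h))"
  proof (intro sum.cong refl)
    fix b assume "b \<in> ?X"
    moreover then have "b \<noteq> 0" using X0 by auto
    ultimately show "?g (?wt b) = ?g (Wt + (int l - 1) * int h)" by (simp add: hweight_word[OF k])
  qed
  also have "(\<Sum>b\<in>?N. ?g (?wt b)) = (\<Sum>b\<in>?N. ?g (Wt + int l * int h))"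
  proof (intro sum.cong refl)
    fix b assume "b \<in> ?N"
    moreover then have "b \<noteq> 0" by auto
    ultimately show "?g (?wt b) = ?g (Wt + int l * int h)" by (simp add: hweight_word[OF k])
  qed
  finally have eq: "int (card {b. ?wt b = w}) = ?g 0 + (int (card ?T) * ?g Wt + int (card ?TX) * ?g (Wt + 2 * int l * int h)
    + (int (card ?X) * ?g (Wt + (int l - 1) * int h) + int (card ?N) * ?g (Wt + int l * int h)))"
    by (simp only: sum_constant)
  have "int (card ?T) = (int l + 1) * int p ^ (e - 2) - 1 - int l * int h"
    unfolding T TX p_power_e_minus_1 by (simp add: p algebra_simps)
  moreover have "int (card ?X) = 2 * int l ^ 2 * int p ^ (e - 2)"
    unfolding cX TX p_power_e_minus_1 by (simp add: p algebra_simps power2_eq_square)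
  moreover from this have "int (card ?N) = 2 * int l * (int l + 1) * int p ^ (e - 2)"
    unfolding cN pe p_power_e_minus_1 by (simp add: p algebra_simps power2_eq_square)
  moreover have "c * ?g v = (if v = w then c else 0)" for c v by simp
  ultimately show ?thesis unfolding eq TX by (simp only: distrib_left add_ac)
qed

section \<open>Squares and nonsquares in terms of the quadratic character\<close>

lemma sq_Fp_eq: "sq_Fp = {u \<in> Fp. eta u = 1}"
proof -
  have "sq_Fp = (\<lambda>c. c ^ 2) ` (Fp - {0})"
    unfolding sq_Fp_def Fp_def by auto
  then show ?thesis using eta_eq_1_iff by blast
qed

lemma nsq_Fp_eq: "nsq_Fp = {u \<in> Fp. eta u = - 1}"
proof -
  have "nsq_Fp = (Fp - {0}) - {u \<in> Fp. eta u = 1}"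
    unfolding nsq_Fp_def sq_Fp_eq Fp_def by auto
  also have "\<dots> = {u \<in> Fp. eta u = - 1}" by (auto simp: eta_def)
  finally show ?thesis .
qed

end

text \<open>The statement below uses \<open>dist\<close> as a variable name.\<close>

hide_const (open) dist

theorem theorem4:
  fixes p e :: nat and i :: nat
  assumes "prime p" and "odd p" and "e > 0" and "e mod 4 = 2" and "p dvd e"
    and "CHAR('a::{finite,field}) = p" and "CARD('a::{finite,field}) = p ^ e"
    and "i \<in> {0, 1}"
  defines "Ci \<equiv> (if i = 0 then (sq_Fp :: 'a set) else nsq_Fp)"
  defines "D \<equiv> {x :: 'a. tr p e (x ^ (p + 1) - x) \<in> Ci}"
  defines "C \<equiv> code p e D"
  defines "W \<equiv> int ((p - 1)^2 div 2 * p ^ (e - 2))"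
  defines "h \<equiv> int (p ^ (e div 2 - 1))"
  defines "dist \<equiv> [(0::int, 1::int),
                   (W, int ((p + 1) div 2 * p ^ (e - 2)) - 1 - int ((p - 1) div 2) * h),
                   (W + int ((p - 1) div 2) * h, int ((p^2 - 1) div 2 * p ^ (e - 2))),
                   (W + int (p - 1) * h, int ((p - 1) div 2 * p ^ (e - 2)) + int ((p - 1) div 2) * h),
                   (W + int ((p - 3) div 2) * h, int ((p - 1)^2 div 2 * p ^ (e - 2)))]"
  shows "card D = (p - 1) div 2 * p ^ (e - 1) + (p - 1) div 2 * p ^ (e div 2 - 1)
     \<and> card C = p ^ e
     \<and> card {hweight D c | c. c \<in> C \<and> c \<noteq> (\<lambda>_. 0)} \<le> 4
     \<and> (\<forall>w::int. int (card {c \<in> C. int (hweight D c) = w})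
                = (\<Sum>(wt, n) \<leftarrow> dist. if wt = w then n else 0))"
proof -
  interpret trace_code p e "TYPE('a)"
    using assms(1-7) by unfold_locales
  define k :: int where "k = (if i = 0 then 1 else - 1)"
  have k: "k = 1 \<or> k = - 1" by (simp add: k_def)
  have Ci: "Ci = {u \<in> Fp. eta u = k}"
    using assms(8) by (auto simp: Ci_def k_def sq_Fp_eq nsq_Fp_eq)
  have D: "D = Dk k" unfolding D_def Ci Dk_def by simp
  have C: "C = range (word k)" unfolding C_def D by (rule code_eq)
  define l where "l = (p - 1) div 2"
  have p: "p = 2 * l + 1" unfolding l_def by (rule p_eq)
  have lpos: "l \<ge> 1" using l_pos by (simp add: l_def)
  have ids: "p - 1 = 2 * l" "(p + 1) div 2 = l + 1" "(p ^ 2 - 1) div 2 = 2 * l * (l + 1)"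
    "(p - 1) ^ 2 div 2 = 2 * l ^ 2"
    by (simp_all add: p power2_eq_square algebra_simps)
  \<comment> \<open>Here \<open>l \<ge> 1\<close> ensures that the natural-number subtraction
    \<open>p - 3\<close> is not truncated.\<close>
  have p3: "int ((p - 3) div 2) = int l - 1" using lpos p by simp
  have W: "W = Wt"
    unfolding W_def Wt_def ids by (simp flip: l_def)
  have dist: "dist = [(0, 1), (W, (int l + 1) * int p ^ (e - 2) - 1 - int l * h),
    (W + int l * h, 2 * int l * (int l + 1) * int p ^ (e - 2)),
    (W + 2 * int l * h, int l * int p ^ (e - 2) + int l * h),
    (W + (int l - 1) * h, 2 * int l ^ 2 * int p ^ (e - 2))]"
    unfolding dist_def p3 ids by (simp add: algebra_simps)
  show ?thesis
  proof (intro conjI allI)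
    have "int (card D) = int (l * p ^ (e - 1) + l * p ^ (e div 2 - 1))"
      unfolding D card_Dk[OF k] by (simp add: l_def algebra_simps)
    then show "card D = (p - 1) div 2 * p ^ (e - 1) + (p - 1) div 2 * p ^ (e div 2 - 1)"
      unfolding l_def by linarith
    show "card C = p ^ e" unfolding C using inj_word[OF k] card by (simp add: card_image)
  next
    \<comment> \<open>These four values cover all nonzero weights; some may coincide, so only an
      upper bound is claimed.\<close>
    let ?V = "{W + 2 * int l * h, W, W + (int l - 1) * h, W + int l * h}"
    have "{hweight D c | c. c \<in> C \<and> c \<noteq> (\<lambda>_. 0)} \<subseteq> nat ` ?V"
    proof safe
      fix c assume c: "c \<in> C" "c \<noteq> (\<lambda>_. 0)"
      obtain b where b: "c = word k b" using c C by auto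
      have "b \<noteq> 0"
      proof
        assume "b = 0"
        \<comment> \<open>Writing \<open>0\<close> as \<open>0 - 0\<close> presents the word as a
          difference of equal words.\<close>
        then have "c = (\<lambda>_. 0)" using word_diff[of k 0 0] b by simp
        then show False using c by simp
      qed
      from hweight_word[OF k this] have "int (hweight D c) \<in> ?V"
        unfolding D b W h_def l_def by (simp split: if_splits)
      then show "hweight D c \<in> nat ` ?V" by (metis imageI nat_int)
    qed
    then have "card {hweight D c | c. c \<in> C \<and> c \<noteq> (\<lambda>_. 0)} \<le> card (nat ` ?V)"
      by (intro card_mono) auto
    also have "\<dots> \<le> card ?V" by (intro card_image_le) auto
    also have "\<dots> \<le> 4" by (simp add: card_insert_if)
    finally show "card {hweight D c | c. c \<in> C \<and> c \<noteq> (\<lambda>_. 0)} \<le> 4" .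
  next
    fix w :: int
    have "{c \<in> C. int (hweight D c) = w} = word k ` {b. int (hweight (Dk k) (word k b)) = w}"
      unfolding C D by auto
    moreover have "inj_on (word k) {b. int (hweight (Dk k) (word k b)) = w}"
      using inj_word[OF k] by (rule inj_on_subset) simp
    ultimately have "card {c \<in> C. int (hweight D c) = w} = card {b. int (hweight (Dk k) (word k b)) = w}"
      by (simp only: card_image)
    then show "int (card {c \<in> C. int (hweight D c) = w}) = (\<Sum>(wt, n) \<leftarrow> dist. if wt = w then n else 0)"
      unfolding dist
      by (simp only: card_hweight_word[OF k, of w, folded W l_def h_def] list.map sum_list.Cons
          sum_list.Nil case_prod_conv add_0_right add.assoc)
  qed
qed

end
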